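(* The sets $T_2$, $\mathrm{Pol}(T_2)$, $T_1\cap T_2$ and $\mathrm{Pol}(T_1\cap T_2)$ are complete coanalytic sets (where $T_2$ and $T_1\cap T_2$ are regarded as subsets of $\mathcal{O}^{(2)}$, and $\mathrm{Pol}(T_2)$ and $\mathrm{Pol}(T_1\cap T_2)$ as subsets of $\mathcal{O}$).
   Context: $\mathbb{N}=\{0,1,2,\dots\}$; $\mathcal{O}^{(n)}=\mathbb{N}^{\mathbb{N}^n}$ is the set of all $n$-ary operations on $\mathbb{N}$ ($n\ge1$), with the product topology ($\mathbb{N}$ discrete), and $\mathcal{O}=\bigcup_{n\ge1}\mathcal{O}^{(n)}$ carries the sum (disjoint union) topology. These are Polish spaces. A subset of a Polish space is coanalytic if its complement is analytic (i.e. empty or a continuous image of $\mathbb{N}^{\mathbb{N}}$). For $\mathcal{X}=\mathcal{O}^{(2)}$ or $\mathcal{X}=\mathcal{O}$, a set $D\subseteq\mathcal{X}$ is complete coanalytic if $D$ is coanalytic and for every coanalytic set $C\subseteq\mathcal{X}$ there is a continuous function $F:\mathcal{X}\to\mathcal{X}$ with $C=F^{-1}[D]$. For $B\subseteq\mathcal{O}^{(2)}$, $\mathrm{Pol}(B)=\bigcup_{k\ge1}\{f\in\mathcal{O}^{(k)}:\forall g_1,\dots,g_k\in B\;\; f(g_1,\dots,g_k)\in B\}$, where $f(g_1,\dots,g_k)(x,y)=f(g_1(x,y),\dots,g_k(x,y))$. A function $f:\mathbb{N}\times\mathbb{N}\to\mathbb{N}$ is almost unary if there is $F:\mathbb{N}\to\mathbb{N}$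 with $f(x,y)\le F(x)$ for all $x,y$, or there is $F:\mathbb{N}\to\mathbb{N}$ with $f(x,y)\le F(y)$ for all $x,y$. $T_1$ is the set of all almost unary functions. Let $\Delta=\{(x,y)\in\mathbb{N}^2:x>y\}$, $\nabla=\{(x,y)\in\mathbb{N}^2:x<y\}$, and for $S_1,S_2\subseteq\mathbb{N}$ let $\Delta_{S_1,S_2}=\Delta\cap(S_1\times S_2)$, $\nabla_{S_1,S_2}=\nabla\cap(S_1\times S_2)$. For infinite $S_1,S_2\subseteq\mathbb{N}$, a function $g:\Delta_{S_1,S_2}\to\mathbb{N}$ or $g:\nabla_{S_1,S_2}\to\mathbb{N}$ is canonical if one of the following holds: (1) $g$ is constant; (2) there is a 1-1 function $G:S_1\to\mathbb{N}$ with $g(x,y)=G(x)$ for all $(x,y)\in\mathrm{dom}(g)$; (3) there is a 1-1 function $G:S_2\to\mathbb{N}$ with $g(x,y)=G(y)$ for all $(x,y)\in\mathrm{dom}(g)$; (4) $g$ is 1-1. A function $f:\mathbb{N}\times\mathbb{N}\to\mathbb{N}$ is canonical on $S_1\times S_2$ (with $S_1,S_2$ infinite) if both restrictions $f|_{\Delta_{S_1,S_2}}$ and $f|_{\nabla_{S_1,S_2}}$ are canonical (not necessarily of the same kind), and moreover either the ranges of these two restrictions are disjoint, or $S_1=S_2$ and $f(x,y)=f(y,x)$ for all $x,y\in S_1$. A function $f:\mathbb{N}\times\mathbb{N}\to\mathbb{N}$ is nowhere injective if, whenever $f$ is canonical on $S_1\times S_2$ (for infinite $S_1,S_2$), neither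 $f|_{\Delta_{S_1,S_2}}$ nor $f|_{\nabla_{S_1,S_2}}$ is 1-1. $T_2$ is the set of all nowhere injective functions. *)

theory Defs
  imports "HOL-Analysis.Analysis"
begin

section \<open>Spaces of finitary operations on the natural numbers\<close>

text \<open>The set of \<open>n\<close>-tuples is the set of lists of length \<open>n\<close>; an \<open>n\<close>-ary operation is a function
  on lists that is \<^const>\<open>undefined\<close> outside this set, i.e. an element of
  \<^term>\<open>{xs. length xs = n} \<rightarrow>\<^sub>E UNIV\<close>.\<close>

definition tuples :: "nat \<Rightarrow> nat list set" where
  "tuples n = {xs. length xs = n}"

definition op_space :: "nat \<Rightarrow> (nat list \<Rightarrow> nat) topology" where
  "op_space n = product_topology (\<lambda>_. discrete_topology UNIV) (tuples n)"

definition all_op_space :: "(nat \<times> (nat list \<Rightarrow> nat)) topology" where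
  "all_op_space = sum_topology op_space {1..}"

lemma topspace_op_space [simp]: "topspace (op_space n) = tuples n \<rightarrow>\<^sub>E UNIV"
  by (simp add: op_space_def)

lemma topspace_all_op_space [simp]:
  "topspace all_op_space = (SIGMA n:{1..}. tuples n \<rightarrow>\<^sub>E UNIV)"
  by (simp add: all_op_space_def comp_def)


section \<open>Analytic, coanalytic and complete coanalytic sets\<close>

definition baire_space :: "(nat \<Rightarrow> nat) topology" where
  "baire_space = product_topology (\<lambda>_. discrete_topology UNIV) UNIV"

definition analytic_in :: "'a topology \<Rightarrow> 'a set \<Rightarrow> bool" where
  "analytic_in X A \<longleftrightarrow>
     A = {} \<or> (\<exists>h. continuous_map baire_space X h \<and> A = h ` topspace baire_space)"

definition coanalytic_in :: "'a topology \<Rightarrow> 'a set \<Rightarrow> bool" where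
  "coanalytic_in X C \<longleftrightarrow> C \<subseteq> topspace X \<and> analytic_in X (topspace X - C)"

definition complete_coanalytic_in :: "'a topology \<Rightarrow> 'a set \<Rightarrow> bool" where
  "complete_coanalytic_in X D \<longleftrightarrow>
     coanalytic_in X D \<and>
     (\<forall>C. coanalytic_in X C \<longrightarrow>
        (\<exists>F. continuous_map X X F \<and> C = {x \<in> topspace X. F x \<in> D}))"


section \<open>Polymorphisms of a set of binary operations\<close>

definition comp_op :: "(nat list \<Rightarrow> nat) \<Rightarrow> (nat list \<Rightarrow> nat) list \<Rightarrow> (nat list \<Rightarrow> nat)" where
  "comp_op f gs = (\<lambda>xs\<in>tuples 2. f (map (\<lambda>g. g xs) gs))"

definition Pol :: "(nat list \<Rightarrow> nat) set \<Rightarrow> (nat \<times> (nat list \<Rightarrow> nat)) set" where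
  "Pol B = {(k, f). k \<ge> 1 \<and> f \<in> topspace (op_space k) \<and>
              (\<forall>gs. length gs = k \<and> set gs \<subseteq> B \<longrightarrow> comp_op f gs \<in> B)}"


section \<open>Almost unary and nowhere injective functions\<close>

definition almost_unary :: "(nat \<times> nat \<Rightarrow> nat) \<Rightarrow> bool" where
  "almost_unary f \<longleftrightarrow>
     (\<exists>F :: nat \<Rightarrow> nat. \<forall>x y. f (x, y) \<le> F x) \<or>
     (\<exists>F :: nat \<Rightarrow> nat. \<forall>x y. f (x, y) \<le> F y)"

definition Delta :: "nat set \<Rightarrow> nat set \<Rightarrow> (nat \<times> nat) set" where
  "Delta S1 S2 = {(x, y). x > y} \<inter> (S1 \<times> S2)"

definition Nabla :: "nat set \<Rightarrow> nat set \<Rightarrow> (nat \<times> nat) set" where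
  "Nabla S1 S2 = {(x, y). x < y} \<inter> (S1 \<times> S2)"

text \<open>In the following definition \<open>D\<close> is the domain of the partial function under consideration,
  either \<^term>\<open>Delta S1 S2\<close> or \<^term>\<open>Nabla S1 S2\<close>.\<close>

definition canonical_restr ::
  "nat set \<Rightarrow> nat set \<Rightarrow> (nat \<times> nat) set \<Rightarrow> (nat \<times> nat \<Rightarrow> nat) \<Rightarrow> bool" where
  "canonical_restr S1 S2 D g \<longleftrightarrow>
     (\<exists>c. \<forall>p\<in>D. g p = c) \<or>
     (\<exists>G :: nat \<Rightarrow> nat. inj_on G S1 \<and> (\<forall>(x, y)\<in>D. g (x, y) = G x)) \<or>
     (\<exists>G :: nat \<Rightarrow> nat. inj_on G S2 \<and> (\<forall>(x, y)\<in>D. g (x, y) = G y)) \<or>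
     inj_on g D"

definition canonical_on :: "nat set \<Rightarrow> nat set \<Rightarrow> (nat \<times> nat \<Rightarrow> nat) \<Rightarrow> bool" where
  "canonical_on S1 S2 f \<longleftrightarrow>
     infinite S1 \<and> infinite S2 \<and>
     canonical_restr S1 S2 (Delta S1 S2) f \<and>
     canonical_restr S1 S2 (Nabla S1 S2) f \<and>
     (f ` Delta S1 S2 \<inter> f ` Nabla S1 S2 = {} \<or>
      (S1 = S2 \<and> (\<forall>x\<in>S1. \<forall>y\<in>S1. f (x, y) = f (y, x))))"

definition nowhere_injective :: "(nat \<times> nat \<Rightarrow> nat) \<Rightarrow> bool" where
  "nowhere_injective f \<longleftrightarrow>
     (\<forall>S1 S2. canonical_on S1 S2 f \<longrightarrow>
        \<not> inj_on f (Delta S1 S2) \<and> \<not> inj_on f (Nabla S1 S2))"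

definition T1 :: "(nat list \<Rightarrow> nat) set" where
  "T1 = {f \<in> topspace (op_space 2). almost_unary (\<lambda>(x, y). f [x, y])}"

definition T2 :: "(nat list \<Rightarrow> nat) set" where
  "T2 = {f \<in> topspace (op_space 2). nowhere_injective (\<lambda>(x, y). f [x, y])}"

end

(* Canonization (Ramsey's theorem for 4-sets) shows that f is nowhere injective iff f is injective
   on no triangle Delta_{S1,S2} or Nabla_{S1,S2} with S1, S2 infinite.  Naively the complement of
   Pol(T2) is Sigma^1_2; but if f(g_1, ..., g_k) is injective on a triangle and all g_i are nowhere
   injective, then after thinning out the triangle every g_i depends on one coordinate only, and
   conversely such g_i, extended by 0, lie in T1 and T2.  Hence being outside Pol(T2) is witnessed by
   a triangle and k unary functions.  Being outside Pol(T1 \<inter> T2) has one further kind of witness, the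
   values of the g_i on one row and one column where f(g_1, ..., g_k) is unbounded.  Both are
   projections of closed sets, and T2, T1 \<inter> T2 are the binary parts of the two clones.

   For hardness, an analytic set is given by trees T_x that depend continuously on x and have a branch
   iff x is in the set.  The operation that sends (p, q) to an injective code of the pair if q is a
   proper initial segment of the node p in T_x, and to 0 otherwise, is almost unary, and it is
   injective on some triangle iff T_x has a branch. *)
theory Submission
  imports Defs "HOL-Library.Ramsey" "HOL-Library.Sublist"
begin

text \<open>The definition of \<open>nowhere_injective\<close> speaks of both triangles at once and
  asks for disjoint ranges or symmetry, while injectivity is known on one triangle only. This shapes
  the canonization: on order-indiscernible sequences, a value common to both triangles would allow
  one coordinate to be moved alone inside the injective triangle.

  Membership of the arguments in \<open>T2\<close> is itself coanalytic, which is the source of the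
  naive bound. For arguments that are unary on a triangle and 0 elsewhere it holds automatically, so
  no such condition survives in the witness. The row-and-column witness works in the same way:
  failing to be almost unary is visible on one row and one column, an almost unary function is
  bounded on one of the two, and every function that vanishes off them is nowhere injective.

  One reduction serves all four sets: its values lie in \<open>T1\<close>, where \<open>T2\<close>
  and \<open>T1 \<inter> T2\<close> coincide, and \<open>Pair 2\<close> embeds the binary operations
  in \<open>all_op_space\<close> and pulls each clone back to its binary part.\<close>

section \<open>Order-indiscernible functions\<close>

text \<open>Whether two values of \<open>F\<close> agree depends only on the order type of the four indices.\<close>
definition indiscernible :: "(nat \<Rightarrow> nat \<Rightarrow> 'a) \<Rightarrow> bool" where
  "indiscernible F \<longleftrightarrow>
     (\<forall>\<phi> i j k l. strict_mono \<phi> \<longrightarrow> (F i j = F k l \<longleftrightarrow> F (\<phi> i) (\<phi> j) = F (\<phi> k) (\<phi> l)))"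

lemma indiscernibleD:
  "indiscernible F \<Longrightarrow> strict_mono \<phi> \<Longrightarrow> F i j = F k l \<longleftrightarrow> F (\<phi> i) (\<phi> j) = F (\<phi> k) (\<phi> l)"
  unfolding indiscernible_def by blast

lemma sorted_list_of_set_image_strict_mono:
  fixes \<phi> :: "nat \<Rightarrow> nat"
  assumes "strict_mono \<phi>" "finite X"
  shows "sorted_list_of_set (\<phi> ` X) = map \<phi> (sorted_list_of_set X)"
proof -
  have "sorted (map \<phi> (sorted_list_of_set X))"
    by (simp add: assms sorted_map sorted_wrt_mono_rel[OF _ sorted_sorted_list_of_set] strict_mono_less_eq)
  moreover have "distinct (map \<phi> (sorted_list_of_set X))"
    using assms by (simp add: distinct_map strict_mono_imp_inj_on inj_on_subset)
  ultimately show ?thesis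
    using assms
    by (simp add: sorted_list_of_set_unique [symmetric] strict_sorted_iff card_image
        strict_mono_imp_inj_on)
qed

text \<open>An equality between two values of \<open>F\<close> involves at most four indices, so it
  suffices to colour each 4-set by the pattern of equalities among its positions and to enumerate a
  homogeneous set.\<close>

lemma ex_indiscernible:
  fixes F :: "nat \<Rightarrow> nat \<Rightarrow> 'a"
  obtains y where "strict_mono y" "indiscernible (\<lambda>i j. F (y i) (y j))"
proof -
  let ?I = "{..<4::nat} \<times> {..<4::nat} \<times> {..<4::nat} \<times> {..<4::nat}"
  define col where "col X = (let t = sorted_list_of_set X in
      {(u, v, w, z) \<in> ?I. F (t ! u) (t ! v) = F (t ! w) (t ! z)})" for X
  have "finite (Pow ?I)" by simp
  then obtain e and s :: nat where e: "bij_betw e (Pow ?I) {0..<s}"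
    using ex_bij_betw_finite_nat by blast
  have col: "col X \<in> Pow ?I" for X by (auto simp: col_def Let_def)
  have "(e \<circ> col) ` nsets UNIV 4 \<subseteq> {..<s}"
    using bij_betwE[OF e] col by auto
  then obtain Y t where Y: "infinite Y" "(e \<circ> col) ` nsets Y 4 \<subseteq> {t}"
    using Ramsey_nsets[of UNIV "e \<circ> col" 4 s] by (metis infinite_UNIV_nat)
  have same: "col X = col X'" if "X \<in> nsets Y 4" "X' \<in> nsets Y 4" for X X'
  proof -
    have "e (col X) = e (col X')" using Y(2) that by auto
    then show ?thesis using e col unfolding bij_betw_def inj_on_def by blast
  qed
  let ?y = "enumerate Y"
  have y: "strict_mono ?y" using Y(1) strict_mono_enumerate by blast
  have yY: "?y i \<in> Y" for i using Y(1) enumerate_in_set by blast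
  have "indiscernible (\<lambda>i j. F (?y i) (?y j))"
    unfolding indiscernible_def
  proof (intro allI impI)
    fix \<phi> :: "nat \<Rightarrow> nat" and i j k l :: nat
    assume \<phi>: "strict_mono \<phi>"
    let ?M = "{i, j, k, l}"
    \<comment> \<open>The four indices may coincide. Padding them to exactly four elements fixes
      positions \<open>u\<close>, \<open>v\<close>, \<open>w\<close>, \<open>z\<close> that both
      \<open>?y\<close> and \<open>?y \<circ> \<phi>\<close> preserve.\<close>
    have "infinite (- ?M)" by (simp add: finite_compl infinite_UNIV_nat)
    then obtain Z where Z: "finite Z" "card Z = 4 - card ?M" "Z \<subseteq> - ?M"
      using infinite_arbitrarily_large by blast
    define X where "X = ?M \<union> Z"
    have "card ?M \<le> 4" by (simp add: card_insert_if)
    moreover have "card X = card ?M + card Z"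
      unfolding X_def using Z by (intro card_Un_disjoint) auto
    ultimately have X: "?M \<subseteq> X" "finite X" "card X = 4"
      using Z by (auto simp: X_def)
    let ?t = "sorted_list_of_set X"
    have lt: "length ?t = 4" using X by simp
    have idx: "\<exists>u<4. x = ?t ! u" if "x \<in> X" for x
      using that X lt by (metis in_set_conv_nth set_sorted_list_of_set)
    obtain u v w z where uvwz: "u<4" "v<4" "w<4" "z<4" "i = ?t!u" "j = ?t!v" "k = ?t!w" "l = ?t!z"
      using idx X by (meson insert_subset)
    have nY: "(\<psi> ` X) \<in> nsets Y 4" if "strict_mono \<psi>" "range \<psi> \<subseteq> Y" for \<psi>
      using that X by (auto simp: nsets_def card_image strict_mono_imp_inj_on inj_on_subset)
    have y\<phi>: "strict_mono (?y \<circ> \<phi>)" using y \<phi> by (simp add: strict_mono_o)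
    have eq: "col (?y ` X) = col ((?y \<circ> \<phi>) ` X)"
      using nY[of ?y] nY[of "?y \<circ> \<phi>"] y y\<phi> yY by (intro same) auto
    have "(u,v,w,z) \<in> col (?y ` X) \<longleftrightarrow> F (?y i) (?y j) = F (?y k) (?y l)"
      using uvwz lt by (simp add: col_def Let_def sorted_list_of_set_image_strict_mono y X)
    moreover have "(u,v,w,z) \<in> col ((?y \<circ> \<phi>) ` X) \<longleftrightarrow> F (?y (\<phi> i)) (?y (\<phi> j)) = F (?y (\<phi> k)) (?y (\<phi> l))"
      using uvwz lt X by (simp add: col_def Let_def sorted_list_of_set_image_strict_mono[OF y\<phi> X(2)] del: image_comp o_apply) simp
    ultimately show "F (?y i) (?y j) = F (?y k) (?y l) \<longleftrightarrow>
        F (?y (\<phi> i)) (?y (\<phi> j)) = F (?y (\<phi> k)) (?y (\<phi> l))"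
      using eq by simp
  qed
  then show ?thesis using that y by blast
qed

lemma ex_strict_mono_three:
  fixes i j k :: nat
  assumes "i < j" "j < k"
  obtains \<phi> :: "nat \<Rightarrow> nat" where "strict_mono \<phi>" "\<phi> 0 = i" "\<phi> 1 = j" "\<phi> 2 = k"
proof
  show "strict_mono (\<lambda>n. if n = 0 then i else if n = 1 then j else k + n - 2)"
    using assms by (auto simp: strict_mono_def)
qed auto

text \<open>\<open>A\<close> says that the second coordinate does not influence the value,
  \<open>B\<close> the same of the first. The four combinations become the four kinds of canonical
  function.\<close>

lemma indiscernible_upper:
  assumes F: "indiscernible F"
  shows "\<exists>A B. \<forall>i j k l. i < j \<longrightarrow> k < l \<longrightarrow> (F i j = F k l \<longleftrightarrow> (A \<or> j = l) \<and> (B \<or> i = k))"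
proof -
  define A B where "A = (F 0 1 = F 0 2)" and "B = (F 0 2 = F 1 2)"
  have A: "F i j = F i k \<longleftrightarrow> A" if "i < j" "j < k" for i j k
  proof -
    obtain \<phi> :: "nat \<Rightarrow> nat" where "strict_mono \<phi>" "\<phi> 0 = i" "\<phi> 1 = j" "\<phi> 2 = k"
      using ex_strict_mono_three[OF \<open>i < j\<close> \<open>j < k\<close>] by blast
    then show ?thesis using indiscernibleD[OF F, of \<phi> 0 1 0 2] A_def by simp
  qed
  have B: "F i k = F j k \<longleftrightarrow> B" if "i < j" "j < k" for i j k
  proof -
    obtain \<phi> :: "nat \<Rightarrow> nat" where "strict_mono \<phi>" "\<phi> 0 = i" "\<phi> 1 = j" "\<phi> 2 = k"
      using ex_strict_mono_three[OF \<open>i < j\<close> \<open>j < k\<close>] by blast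
    then show ?thesis using indiscernibleD[OF F, of \<phi> 0 2 1 2] B_def by simp
  qed
  have A': "F i j = F i k \<longleftrightarrow> A \<or> j = k" if "i < j" "i < k" for i j k
    using A[of i j k] A[of i k j] that by (metis nat_neq_iff)
  have B': "F i k = F j k \<longleftrightarrow> B \<or> i = j" if "i < k" "j < k" for i j k
    using B[of i j k] B[of j i k] that by (metis nat_neq_iff)
  \<comment> \<open>The index \<open>l\<close> exceeds the other three, so it can be shifted alone;
    \<open>F k l\<close> and \<open>F k (l + 1)\<close> then both equal
    \<open>F i j\<close>.\<close>
  have up: A if "F i j = F k l" "i < j" "k < l" "j < l" for i j k l
  proof -
    let ?\<phi> = "\<lambda>n. if n < l then n else n + 1"
    have "strict_mono ?\<phi>" by (auto simp: strict_mono_def)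
    from indiscernibleD[OF F this, of i j k l] that have "F i j = F k (l + 1)" by simp
    then have "F k l = F k (l + 1)" using that by simp
    then show A using A'[of k l "l + 1"] \<open>k < l\<close> by simp
  qed
  have main: "F i j = F k l \<longleftrightarrow> (A \<or> j = l) \<and> (B \<or> i = k)" if "i < j" "k < l" for i j k l
  proof (cases "j = l")
    case True
    then show ?thesis using B' that by simp
  next
    case False
    show ?thesis
    proof (cases A)
      case True
      \<comment> \<open>Under \<open>A\<close> both points can be moved to a common second
        coordinate beyond all indices, where \<open>B\<close> alone decides.\<close>
      define m where "m = Suc (max j l)"
      have "F i j = F i m" "F k l = F k m"
        using A'[of i j m] A'[of k l m] True that by (auto simp: m_def)
      moreover have "F i m = F k m \<longleftrightarrow> B \<or> i = k" using that by (intro B') (auto simp: m_def)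
      ultimately show ?thesis using True by simp
    next
      case nA: False
      then have "F i j \<noteq> F k l"
        using False that up[of i j k l] up[of k l i j] by (cases j l rule: linorder_cases) auto
      then show ?thesis using nA False by simp
    qed
  qed
  show ?thesis by (rule exI[of _ A], rule exI[of _ B]) (simp add: main)
qed

lemma indiscernible_lower:
  assumes F: "indiscernible F"
  shows "\<exists>A B. \<forall>i j k l. j < i \<longrightarrow> l < k \<longrightarrow> (F i j = F k l \<longleftrightarrow> (A \<or> j = l) \<and> (B \<or> i = k))"
proof -
  have "indiscernible (\<lambda>i j. F j i)"
    using F unfolding indiscernible_def by blast
  from indiscernible_upper[OF this] obtain A B where
    "\<forall>i j k l. i < j \<longrightarrow> k < l \<longrightarrow> (F j i = F l k \<longleftrightarrow> (A \<or> j = l) \<and> (B \<or> i = k))"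
    by (elim exE)
  then show ?thesis by (rule_tac exI[of _ B], rule_tac exI[of _ A]) auto
qed

text \<open>Doubling leaves a free slot after every index. If only \<open>i\<close> moves into its
  slot, the other three indices stay, so both values equal \<open>F (2 * k) (2 * l)\<close>.\<close>

lemma indiscernible_separate:
  assumes F: "indiscernible F" and "F i j = F k l" "i \<notin> {j, k, l}"
  shows "F (2 * i) (2 * j) = F (2 * i + 1) (2 * j)"
proof -
  let ?\<psi> = "\<lambda>n. if n = i then 2 * n + 1 else 2 * n :: nat"
  have "strict_mono (\<lambda>n. 2 * n :: nat)" "strict_mono ?\<psi>" by (auto simp: strict_mono_def)
  then show ?thesis
    using indiscernibleD[OF F, of "\<lambda>n. 2*n" i j k l] indiscernibleD[OF F, of ?\<psi> i j k l] assms by auto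
qed

lemma indiscernible_separate':
  assumes F: "indiscernible F" and "F i j = F k l" "j \<notin> {i, k, l}"
  shows "F (2 * i) (2 * j) = F (2 * i) (2 * j + 1)"
proof -
  let ?\<psi> = "\<lambda>n. if n = j then 2 * n + 1 else 2 * n :: nat"
  have "strict_mono (\<lambda>n. 2 * n :: nat)" "strict_mono ?\<psi>" by (auto simp: strict_mono_def)
  then show ?thesis
    using indiscernibleD[OF F, of "\<lambda>n. 2*n" i j k l] indiscernibleD[OF F, of ?\<psi> i j k l] assms by auto
qed


section \<open>Canonization on triangles\<close>

definition tri :: "bool \<Rightarrow> nat set \<Rightarrow> nat set \<Rightarrow> (nat \<times> nat) set" where
  "tri c S1 S2 = (if c then Delta S1 S2 else Nabla S1 S2)"

lemma mem_tri:
  "(x, y) \<in> tri c S1 S2 \<longleftrightarrow> x \<in> S1 \<and> y \<in> S2 \<and> (if c then y < x else x < y)"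
  by (auto simp: tri_def Delta_def Nabla_def)

lemma tri_mono: "S1 \<subseteq> S1' \<Longrightarrow> S2 \<subseteq> S2' \<Longrightarrow> tri c S1 S2 \<subseteq> tri c S1' S2'"
  by (auto simp: tri_def Delta_def Nabla_def)

lemma ex_large_inj_on:
  fixes S :: "nat set" and G :: "nat \<Rightarrow> nat"
  assumes "infinite S" "inj_on G S"
  shows "\<exists>x\<in>S. m < x \<and> n < G x"
proof -
  have "finite (G -` {..n} \<inter> S)" using assms(2) by (intro finite_vimage_IntI) auto
  then have "infinite (S - ({..m} \<union> (G -` {..n} \<inter> S)))"
    using assms(1) by (intro Diff_infinite_finite) auto
  then show ?thesis by (force dest!: infinite_imp_nonempty)
qed

text \<open>The points and their images alternate in the same way, so \<open>x i < y j\<close> and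
  \<open>G (x i) < H (y j)\<close> hold for the same indices; this transports a triangle along
  \<open>G\<close> and \<open>H\<close>. With the identity for both it is plain
  interleaving.\<close>

lemma ex_interleaved:
  fixes G H :: "nat \<Rightarrow> nat"
  assumes "infinite S1" "infinite S2" "inj_on G S1" "inj_on H S2"
  obtains x y :: "nat \<Rightarrow> nat"
  where "\<And>i. x i \<in> S1" "\<And>i. y i \<in> S2" "\<And>i. x i < y i" "\<And>i. y i < x (Suc i)"
    "\<And>i. G (x i) < H (y i)" "\<And>i. H (y i) < G (x (Suc i))"
proof -
  obtain p where p: "\<And>m n. p m n \<in> S1 \<and> m < p m n \<and> n < G (p m n)"
    using ex_large_inj_on[OF assms(1,3)] by metis
  obtain q where q: "\<And>m n. q m n \<in> S2 \<and> m < q m n \<and> n < H (q m n)"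
    using ex_large_inj_on[OF assms(2,4)] by metis
  \<comment> \<open>The recursion runs over \<open>x\<close> alone: \<open>u\<close> is the previous
    \<open>x i\<close>, and \<open>q u (G u)\<close> is the \<open>y i\<close> that follows
    it.\<close>
  define x where "x = rec_nat (p 0 0) (\<lambda>_ u. p (q u (G u)) (H (q u (G u))))"
  define y where "y i = q (x i) (G (x i))" for i
  have x: "x (Suc i) = p (y i) (H (y i))" for i by (simp add: x_def y_def)
  have xS: "x i \<in> S1" for i
    using p by (cases i) (simp_all add: x, simp add: x_def)
  show ?thesis
    by (rule that[of x y]) (use p q xS in \<open>auto simp: x\<close>, auto simp: y_def)
qed

lemma interleaved_strict_mono:
  fixes x y :: "nat \<Rightarrow> nat"
  assumes "\<And>i. x i < y i" "\<And>i. y i < x (Suc i)"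
  shows "strict_mono x" "strict_mono y"
  using assms by (meson strict_mono_Suc_iff less_trans)+

lemma interleaved_less_iff:
  fixes x y :: "nat \<Rightarrow> nat"
  assumes "\<And>i. x i < y i" "\<And>i. y i < x (Suc i)"
  shows "x i < y j \<longleftrightarrow> i \<le> j" "y j < x i \<longleftrightarrow> j < i"
proof -
  have x: "strict_mono x" using interleaved_strict_mono assms by blast
  have 1: "x i < y j" if "i \<le> j"
    using that x assms(1)[of j] by (meson le_less_trans strict_mono_less_eq)
  have 2: "y j < x i" if "j < i"
    using that x assms(2)[of j] by (meson Suc_leI less_le_trans strict_mono_less_eq)
  show "x i < y j \<longleftrightarrow> i \<le> j" "y j < x i \<longleftrightarrow> j < i"
    using 1 2 by (meson leI less_asym)+
qed

text \<open>Since \<open>S1\<close> and \<open>S2\<close> may be disjoint, Ramsey's theorem is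
  applied to the indices of two interleaved sequences instead of to a common subset.\<close>

lemma ex_indiscernible_interleaved:
  fixes f :: "nat \<times> nat \<Rightarrow> nat"
  assumes "infinite S1" "infinite S2"
  obtains a b :: "nat \<Rightarrow> nat"
  where "\<And>i. a i \<in> S1" "\<And>i. b i \<in> S2" "\<And>i. a i < b i" "\<And>i. b i < a (Suc i)"
    "indiscernible (\<lambda>i j. f (a i, b j))"
proof -
  obtain x y :: "nat \<Rightarrow> nat" where xy: "\<And>i. x i \<in> S1" "\<And>i. y i \<in> S2" "\<And>i. x i < y i" "\<And>i. y i < x (Suc i)"
    using ex_interleaved[OF assms, of "\<lambda>x. x" "\<lambda>x. x"] by (metis inj_on_id2)
  obtain s where s: "strict_mono s" "indiscernible (\<lambda>i j. f (x (s i), y (s j)))"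
    using ex_indiscernible[of "\<lambda>i j. f (x i, y j)"] by blast
  have "y (s i) < x (s (Suc i))" for i
    using interleaved_less_iff(2)[of x y] xy s(1) by (simp add: strict_mono_Suc_iff)
  then show ?thesis
    by (intro that[of "x \<circ> s" "y \<circ> s"]) (use xy s in auto)
qed

definition ord :: "bool \<Rightarrow> nat \<Rightarrow> nat \<Rightarrow> bool" where
  "ord c i j = (if c then j < i else i < j)"

lemma mem_tri_ord: "(x, y) \<in> tri c S1 S2 \<longleftrightarrow> x \<in> S1 \<and> y \<in> S2 \<and> ord c x y"
  by (simp add: mem_tri ord_def)

lemma indiscernible_ord:
  assumes F: "indiscernible F"
  shows "\<exists>A B. \<forall>i j k l. ord c i j \<longrightarrow> ord c k l \<longrightarrow>
    (F i j = F k l \<longleftrightarrow> (A \<or> j = l) \<and> (B \<or> i = k))"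
  using indiscernible_lower[OF F] indiscernible_upper[OF F] by (cases c) (simp_all add: ord_def)

section \<open>Canonical restrictions of an indiscernible grid\<close>

locale indiscernible_grid =
  fixes f :: "nat \<times> nat \<Rightarrow> nat" and a b :: "nat \<Rightarrow> nat"
  assumes ab: "\<And>i. a i < b i" and ba: "\<And>i. b i < a (Suc i)"
    and indisc: "indiscernible (\<lambda>i j. f (a i, b j))"
begin

text \<open>Rows have even and columns odd indices, so that a point above the diagonal and one below it
  never have the same set of indices.  The indices 0 and 1 are left free: they supply the values of
  the unary function of a canonical restriction at the least elements of \<open>R1\<close> and \<open>R2\<close>, where
  the triangle may be empty.\<close>
definition "R1 = range (\<lambda>i. a (2 * i + 2))"
definition "R2 = range (\<lambda>i. b (2 * i + 3))"

lemma mono: "strict_mono a" "strict_mono b"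
  using interleaved_strict_mono ab ba by blast+

lemma inj: "a i = a j \<longleftrightarrow> i = j" "b i = b j \<longleftrightarrow> i = j"
  using mono by (simp_all add: strict_mono_eq)

lemma infinite_R: "infinite R1" "infinite R2"
  by (auto simp: R1_def R2_def intro!: range_inj_infinite injI simp: inj)

lemma triE:
  assumes "p \<in> tri c R1 R2"
  obtains i j where "p = (a i, b j)" "ord c i j" "i > 0" "j > 0" "even i" "odd j"
proof -
  obtain i j where p: "p = (a (2 * i + 2), b (2 * j + 3))"
    using assms by (cases p) (auto simp: mem_tri R1_def R2_def)
  \<comment> \<open>\<open>a i < b j\<close> gives only \<open>i \<le> j\<close> for the indices;
    their different parity makes the inequality strict, as \<open>ord\<close> demands.\<close>
  have "2 * i + 2 \<noteq> 2 * j + 3" by presburger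
  then have "ord c (2 * i + 2) (2 * j + 3)"
    using assms unfolding p mem_tri ord_def interleaved_less_iff[of a b, OF ab ba]
    by (cases c) simp_all
  then show ?thesis using p by (intro that[of "2 * i + 2" "2 * j + 3"]) auto
qed

lemma canonical: "canonical_restr R1 R2 (tri c R1 R2) f"
proof -
  from indiscernible_ord[OF indisc, of c] obtain A B where "\<forall>i j k l. ord c i j \<longrightarrow> ord c k l \<longrightarrow>
    (f (a i, b j) = f (a k, b l) \<longleftrightarrow> (A \<or> j = l) \<and> (B \<or> i = k))"
    by (elim exE)
  note law = this[rule_format]
  have inv: "inv a (a i) = i" "inv b (b i) = i" for i
    using mono by (simp_all add: strict_mono_imp_inj_on)
  consider "A" "B" | "A" "\<not> B" | "\<not> A" "B" | "\<not> A" "\<not> B" by blast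
  then show ?thesis
  proof cases
    case 1
    define i0 j0 :: nat where "i0 = (if c then 1 else 0)" and "j0 = (if c then 0 else 1)"
    have o: "ord c i0 j0" by (simp add: ord_def i0_def j0_def)
    have "\<forall>p\<in>tri c R1 R2. f p = f (a i0, b j0)"
    proof
      fix p assume "p \<in> tri c R1 R2"
      then obtain i j where "p = (a i, b j)" "ord c i j" by (rule triE)
      then show "f p = f (a i0, b j0)" using law[OF _ o, of i j] 1 by simp
    qed
    then show ?thesis unfolding canonical_restr_def by blast
  next
    case 2
    define G where "G = (\<lambda>x. f (x, b (if c then 0 else inv a x + 1)))"
    have o: "i > 0 \<Longrightarrow> ord c i (if c then 0 else i + 1)" for i by (simp add: ord_def)
    have "inj_on G R1"
    proof (rule inj_onI)
      fix x x' assume "x \<in> R1" "x' \<in> R1" "G x = G x'"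
      moreover from this obtain i k where "x = a i" "x' = a k" "i > 0" "k > 0"
        unfolding R1_def by (auto 0 4)
      ultimately show "x = x'" using law[OF o o, of i k] 2 by (simp add: G_def inv cong: if_cong)
    qed
    moreover have "\<forall>(x, y)\<in>tri c R1 R2. f (x, y) = G x"
    proof clarify
      fix x y assume "(x, y) \<in> tri c R1 R2"
      then obtain i j where "(x, y) = (a i, b j)" "ord c i j" "i > 0" by (rule triE)
      then show "f (x, y) = G x" using law[OF _ o, of i j i] 2 by (simp add: G_def inv cong: if_cong)
    qed
    ultimately show ?thesis unfolding canonical_restr_def by blast
  next
    case 3
    define G where "G = (\<lambda>y. f (a (if c then inv b y + 1 else 0), y))"
    have o: "j > 0 \<Longrightarrow> ord c (if c then j + 1 else 0) j" for j by (simp add: ord_def)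
    have "inj_on G R2"
    proof (rule inj_onI)
      fix y y' assume "y \<in> R2" "y' \<in> R2" "G y = G y'"
      moreover from this obtain j l where "y = b j" "y' = b l" "j > 0" "l > 0"
        unfolding R2_def by (auto 0 4)
      ultimately show "y = y'" using law[OF o o, of j l] 3 by (simp add: G_def inv cong: if_cong)
    qed
    moreover have "\<forall>(x, y)\<in>tri c R1 R2. f (x, y) = G y"
    proof clarify
      fix x y assume "(x, y) \<in> tri c R1 R2"
      then obtain i j where "(x, y) = (a i, b j)" "ord c i j" "i > 0" "j > 0" by (rule triE)
      then show "f (x, y) = G y" using law[OF _ o, of i j j] 3 by (simp add: G_def inv cong: if_cong)
    qed
    ultimately show ?thesis unfolding canonical_restr_def by blast
  next
    case 4
    have "inj_on f (tri c R1 R2)"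
      by (rule inj_onI) (elim triE, use law 4 in simp)
    then show ?thesis unfolding canonical_restr_def by blast
  qed
qed

text \<open>A value shared by the two triangles would survive moving one coordinate of its point in
  triangle \<open>c\<close>, and two distinct points there would have the same value.\<close>

lemma disjoint_images:
  assumes inj: "inj_on f (tri c (range a) (range b))"
  shows "f ` Delta R1 R2 \<inter> f ` Nabla R1 R2 = {}"
proof (rule ccontr)
  let ?F = "\<lambda>i j. f (a i, b j)"
  have mem: "(a i, b j) \<in> tri c (range a) (range b)" if "ord c i j" for i j
    using that unfolding mem_tri ord_def interleaved_less_iff[of a b, OF ab ba]
    by (auto split: if_splits)
  have False if eq: "?F i j = ?F k l" and ij: "ord c i j" and kl: "ord (\<not> c) k l"
    and par: "even i" "odd j" "even k" "odd l" for i j k l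
  proof -
    \<comment> \<open>Parity separates row indices from column indices, and the two points lie on
      opposite sides of the diagonal, so \<open>i\<close> or \<open>j\<close> differs from all other
      indices and can be moved alone.\<close>
    have "i \<notin> {j, l}" "j \<notin> {i, k}" using par by auto
    moreover have "i \<noteq> k \<or> j \<noteq> l" using ij kl by (auto simp: ord_def split: if_splits)
    ultimately consider "i \<notin> {j, k, l}" | "j \<notin> {i, k, l}" by blast
    then show False
    proof cases
      case 1
      have "ord c (2 * i) (2 * j)" "ord c (2 * i + 1) (2 * j)"
        using ij by (auto simp: ord_def split: if_splits)
      then show False
        using indiscernible_separate[OF indisc eq 1] inj_onD[OF inj] mem
        by (metis Pair_inject Suc_eq_plus1 indiscernible_grid.inj(1) indiscernible_grid_axioms n_not_Suc_n)
    next
      case 2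
      have "ord c (2 * i) (2 * j)" "ord c (2 * i) (2 * j + 1)"
        using ij by (auto simp: ord_def split: if_splits)
      then show False
        using indiscernible_separate'[OF indisc eq 2] inj_onD[OF inj] mem
        by (metis Pair_inject Suc_eq_plus1 indiscernible_grid.inj(2) indiscernible_grid_axioms n_not_Suc_n)
    qed
  qed note * = this
  assume "f ` Delta R1 R2 \<inter> f ` Nabla R1 R2 \<noteq> {}"
  then obtain p q where "p \<in> tri True R1 R2" "q \<in> tri False R1 R2" "f p = f q"
    unfolding tri_def by auto
  then have "\<exists>p q. p \<in> tri c R1 R2 \<and> q \<in> tri (\<not> c) R1 R2 \<and> f p = f q"
    by (metis (full_types))
  then show False by (auto elim!: triE dest: *)
qed

end

lemma nowhere_injective_iff:
  "nowhere_injective f \<longleftrightarrow>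
     (\<forall>c S1 S2. infinite S1 \<longrightarrow> infinite S2 \<longrightarrow> \<not> inj_on f (tri c S1 S2))"
proof
  assume r: "\<forall>c S1 S2. infinite S1 \<longrightarrow> infinite S2 \<longrightarrow> \<not> inj_on f (tri c S1 S2)"
  show "nowhere_injective f"
    unfolding nowhere_injective_def canonical_on_def
    using r[rule_format, of _ _ True] r[rule_format, of _ _ False] by (auto simp: tri_def)
next
  assume l: "nowhere_injective f"
  show "\<forall>c S1 S2. infinite S1 \<longrightarrow> infinite S2 \<longrightarrow> \<not> inj_on f (tri c S1 S2)"
  proof (intro allI impI notI)
    fix c S1 S2 assume S: "infinite S1" "infinite S2" and inj: "inj_on f (tri c S1 S2)"
    obtain a b :: "nat \<Rightarrow> nat" where mem: "\<And>i. a i \<in> S1" "\<And>i. b i \<in> S2"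
      and "\<And>i. a i < b i" "\<And>i. b i < a (Suc i)" "indiscernible (\<lambda>i j. f (a i, b j))"
      using ex_indiscernible_interleaved[OF S] by blast
    then interpret indiscernible_grid f a b by unfold_locales
    have inj': "inj_on f (tri c (range a) (range b))"
      by (rule inj_on_subset[OF \<open>inj_on f (tri c S1 S2)\<close>], rule tri_mono) (use mem in auto)
    then have "canonical_on R1 R2 f"
      unfolding canonical_on_def using infinite_R disjoint_images canonical[of True] canonical[of False]
      by (auto simp: tri_def)
    moreover have "inj_on f (tri c R1 R2)"
      by (rule inj_on_subset[OF inj'], rule tri_mono) (use mem in \<open>auto simp: R1_def R2_def\<close>)
    ultimately show False
      using l unfolding nowhere_injective_def tri_def by (cases c) auto
  qed
qed

section \<open>Nowhere injective functions and unary restrictions\<close>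

definition unary_on :: "(nat \<times> nat) set \<Rightarrow> (nat \<times> nat \<Rightarrow> nat) \<Rightarrow> bool" where
  "unary_on D g \<longleftrightarrow> (\<exists>e G. \<forall>(x, y)\<in>D. g (x, y) = G (if e then x else y))"

lemma unary_on_subset: "unary_on D g \<Longrightarrow> D' \<subseteq> D \<Longrightarrow> unary_on D' g"
  unfolding unary_on_def by blast

text \<open>Of the four canonical kinds the injective one is excluded, and each of the others
  depends on at most one coordinate.\<close>

lemma ex_unary_on:
  assumes "nowhere_injective g" "infinite S1" "infinite S2"
  shows "\<exists>S1' S2'. S1' \<subseteq> S1 \<and> S2' \<subseteq> S2 \<and> infinite S1' \<and> infinite S2' \<and> unary_on (tri c S1' S2') g"
proof -
  obtain a b :: "nat \<Rightarrow> nat" where mem: "\<And>i. a i \<in> S1" "\<And>i. b i \<in> S2"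
    and "\<And>i. a i < b i" "\<And>i. b i < a (Suc i)" "indiscernible (\<lambda>i j. g (a i, b j))"
    using ex_indiscernible_interleaved[OF assms(2,3)] by blast
  then interpret indiscernible_grid g a b by unfold_locales
  have "\<not> inj_on g (tri c R1 R2)"
    using assms(1) infinite_R nowhere_injective_iff by blast
  then have "unary_on (tri c R1 R2) g"
    using canonical[of c] unfolding canonical_restr_def
  proof (elim disjE exE conjE)
    fix d assume "\<forall>p\<in>tri c R1 R2. g p = d"
    then show ?thesis unfolding unary_on_def by (intro exI[of _ True] exI[of _ "\<lambda>_. d"]) auto
  next
    fix G assume "\<forall>(x, y)\<in>tri c R1 R2. g (x, y) = G x"
    then show ?thesis unfolding unary_on_def by (intro exI[of _ True] exI[of _ G]) auto
  next
    fix G assume "\<forall>(x, y)\<in>tri c R1 R2. g (x, y) = G y"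
    then show ?thesis unfolding unary_on_def by (intro exI[of _ False] exI[of _ G]) auto
  qed simp
  moreover have "R1 \<subseteq> S1" "R2 \<subseteq> S2" using mem by (auto simp: R1_def R2_def)
  ultimately show ?thesis using infinite_R by blast
qed

lemma ex_unary_on_list:
  assumes "\<forall>g\<in>set gs. nowhere_injective g" "infinite S1" "infinite S2"
  shows "\<exists>S1' S2'. S1' \<subseteq> S1 \<and> S2' \<subseteq> S2 \<and> infinite S1' \<and> infinite S2' \<and>
    (\<forall>g\<in>set gs. unary_on (tri c S1' S2') g)"
  using assms
proof (induction gs arbitrary: S1 S2)
  case Nil
  then show ?case by auto
next
  case (Cons g gs)
  obtain S1' S2' where 1: "S1' \<subseteq> S1" "S2' \<subseteq> S2" "infinite S1'" "infinite S2'"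
    "\<forall>g\<in>set gs. unary_on (tri c S1' S2') g"
    using Cons.IH[of S1 S2] Cons.prems by auto
  obtain S1'' S2'' where 2: "S1'' \<subseteq> S1'" "S2'' \<subseteq> S2'" "infinite S1''" "infinite S2''"
    "unary_on (tri c S1'' S2'') g"
    using ex_unary_on[of g S1' S2' c] Cons.prems 1 by auto
  then have "\<forall>g\<in>set (g # gs). unary_on (tri c S1'' S2'') g"
    using 1 unary_on_subset tri_mono by (metis set_ConsD)
  then show ?case using 1 2 by (meson subset_trans)
qed

text \<open>Two elements of the set of smaller coordinates are taken below two elements of the other
  set, so all four pairs lie on the same side of the diagonal.\<close>

lemma ex_rectangle:
  assumes "infinite S1" "infinite S2"
  obtains x x' y y' where "x \<noteq> x'" "y \<noteq> y'" "{x, x'} \<times> {y, y'} \<subseteq> tri c S1 S2"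
proof -
  have gt: "\<exists>x\<in>S. n < x" if "infinite S" for S and n :: nat
    using that infinite_nat_iff_unbounded by blast
  define A B where "A = (if c then S2 else S1)" and "B = (if c then S1 else S2)"
  have AB: "infinite A" "infinite B" using assms by (auto simp: A_def B_def)
  obtain u where "u \<in> A" using gt[OF AB(1)] by blast
  obtain u' where "u' \<in> A" "u < u'" using gt[OF AB(1)] by blast
  obtain v where "v \<in> B" "u' < v" using gt[OF AB(2)] by blast
  obtain v' where "v' \<in> B" "v < v'" using gt[OF AB(2)] by blast
  note uv = \<open>u \<in> A\<close> \<open>u' \<in> A\<close> \<open>u < u'\<close> \<open>v \<in> B\<close> \<open>u' < v\<close> \<open>v' \<in> B\<close> \<open>v < v'\<close>
  show ?thesis
  proof (cases c)
    case True
    with uv show ?thesis by (intro that[of v v' u u']) (auto simp: mem_tri A_def B_def)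
  next
    case False
    with uv show ?thesis by (intro that[of u u' v v']) (auto simp: mem_tri A_def B_def)
  qed
qed

text \<open>Of the four vertices of a rectangle at most one can be a zero of an injective function, so
  one of its rows and one of its columns lie in \<open>D\<close>.\<close>
lemma nowhere_injective_unary_on:
  assumes "unary_on D g" "\<And>p. p \<notin> D \<Longrightarrow> g p = 0"
  shows "nowhere_injective g"
  unfolding nowhere_injective_iff
proof (intro allI impI notI)
  fix c S1 S2 assume S: "infinite (S1 :: nat set)" "infinite (S2 :: nat set)" and inj: "inj_on g (tri c S1 S2)"
  obtain x x' y y' where r: "x \<noteq> x'" "y \<noteq> y'" "{x, x'} \<times> {y, y'} \<subseteq> tri c S1 S2"
    using ex_rectangle[OF S] by blast
  have neq: "g p \<noteq> g q" if "p \<noteq> q" "p \<in> {x, x'} \<times> {y, y'}" "q \<in> {x, x'} \<times> {y, y'}" for p q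
    using inj_onD[OF inj] that r(3) by blast
  obtain e G where G: "\<And>x y. (x, y) \<in> D \<Longrightarrow> g (x, y) = G (if e then x else y)"
    using assms(1) unfolding unary_on_def by blast
  have D: "p \<in> D \<or> q \<in> D" if "p \<noteq> q" "p \<in> {x, x'} \<times> {y, y'}" "q \<in> {x, x'} \<times> {y, y'}" for p q
    using neq[OF that] assms(2) by metis
  have row: "\<not> ((u, y) \<in> D \<and> (u, y') \<in> D)" if "u \<in> {x, x'}" e for u
    using G[of u y] G[of u y'] neq[of "(u, y)" "(u, y')"] that r by auto
  have col: "\<not> ((x, v) \<in> D \<and> (x', v) \<in> D)" if "v \<in> {y, y'}" "\<not> e" for v
    using G[of x v] G[of x' v] neq[of "(x, v)" "(x', v)"] that r by auto
  show False
    using row[of x] row[of x'] col[of y] col[of y'] D[of "(x, y)" "(x', y')"] D[of "(x, y)" "(x', y)"]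
      D[of "(x, y)" "(x, y')"] D[of "(x', y)" "(x, y')"] D[of "(x', y)" "(x', y')"]
      D[of "(x, y')" "(x', y')"] r by auto
qed

text \<open>Deleting one row and one column leaves infinite sets, hence a rectangle on which
  \<open>g\<close> is constantly 0.\<close>

lemma nowhere_injective_cross:
  assumes "\<And>x y. x \<noteq> x0 \<Longrightarrow> y \<noteq> y0 \<Longrightarrow> g (x, y) = 0"
  shows "nowhere_injective g"
  unfolding nowhere_injective_iff
proof (intro allI impI notI)
  fix c S1 S2 assume S: "infinite (S1 :: nat set)" "infinite (S2 :: nat set)" and inj: "inj_on g (tri c S1 S2)"
  have "infinite (S1 - {x0})" "infinite (S2 - {y0})" using S by auto
  then obtain x x' y y' where r: "x \<noteq> x'" "y \<noteq> y'" "{x, x'} \<times> {y, y'} \<subseteq> tri c (S1 - {x0}) (S2 - {y0})"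
    using ex_rectangle by metis
  then have "(x, y) \<in> tri c S1 S2" "(x', y) \<in> tri c S1 S2" "g (x, y) = 0" "g (x', y) = 0"
    using assms by (auto simp: mem_tri)
  then show False using inj_onD[OF inj, of "(x, y)" "(x', y)"] r(1) by simp
qed

lemma inj_on_tri_swap:
  "inj_on (\<lambda>(x, y). f (y, x)) (tri c S1 S2) \<longleftrightarrow> inj_on f (tri (\<not> c) S2 S1)"
proof -
  have "tri (\<not> c) S2 S1 = prod.swap ` tri c S1 S2"
    by (force simp: tri_def Delta_def Nabla_def image_iff)
  moreover have "(\<lambda>(x, y). f (y, x)) = f \<circ> prod.swap" by auto
  ultimately show ?thesis
    by (simp add: comp_inj_on_iff [symmetric] inj_on_subset[OF inj_swap])
qed

text \<open>Injectivity of the composition forces \<open>G\<close> and \<open>H\<close> to be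
  injective far out. Their values are then unbounded, and interleaving makes the order of the images
  agree with the order of the arguments, so \<open>f\<close> is injective on a triangle of
  images.\<close>

lemma inj_on_tri_unary_args:
  fixes f :: "nat \<times> nat \<Rightarrow> nat" and G H :: "nat \<Rightarrow> nat"
  assumes S: "infinite S1" "infinite S2" and inj: "inj_on (\<lambda>(x, y). f (G x, H y)) (tri c S1 S2)"
  shows "\<exists>S1' S2'. infinite S1' \<and> infinite S2' \<and> inj_on f (tri c S1' S2')"
proof -
  obtain x0 y0 where xy0: "x0 \<in> S1" "y0 \<in> S2" using S by (metis ex_in_conv finite.emptyI)
  \<comment> \<open>Any two elements of \<open>U1\<close>, and any two of \<open>U2\<close>, have a
    common partner inside the triangle: \<open>y0\<close> or \<open>x0\<close> itself for one value
    of \<open>c\<close>, a large element for the other.\<close>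
  define U1 U2 where "U1 = S1 - {..y0}" and "U2 = S2 - {..x0}"
  have T: "infinite U1" "infinite U2" using S by (auto simp: U1_def U2_def)
  have gt: "\<exists>x\<in>S. n < x" if "infinite S" for S and n :: nat
    using that infinite_nat_iff_unbounded by blast
  have G: "inj_on G U1"
  proof (rule inj_onI)
    fix x x' assume *: "x \<in> U1" "x' \<in> U1" "G x = G x'"
    obtain y where "y \<in> S2" "max x x' < y" using gt[OF S(2)] by blast
    then obtain z where "(x, z) \<in> tri c S1 S2" "(x', z) \<in> tri c S1 S2"
      using * xy0 by (intro that[of "if c then y0 else y"]) (auto simp: U1_def mem_tri)
    then show "x = x'" using inj_onD[OF inj, of "(x, z)" "(x', z)"] *(3) by simp
  qed
  have H: "inj_on H U2"
  proof (rule inj_onI)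
    fix y y' assume *: "y \<in> U2" "y' \<in> U2" "H y = H y'"
    obtain x where "x \<in> S1" "max y y' < x" using gt[OF S(1)] by blast
    then obtain z where "(z, y) \<in> tri c S1 S2" "(z, y') \<in> tri c S1 S2"
      using * xy0 by (intro that[of "if c then x else x0"]) (auto simp: U2_def mem_tri)
    then show "y = y'" using inj_onD[OF inj, of "(z, y)" "(z, y')"] *(3) by simp
  qed
  obtain x y where xy: "\<And>i. x i \<in> U1" "\<And>i. y i \<in> U2" "\<And>i. x i < y i" "\<And>i. y i < x (Suc i)"
    "\<And>i. G (x i) < H (y i)" "\<And>i. H (y i) < G (x (Suc i))"
    using ex_interleaved[OF T G H] by blast
  let ?R1 = "range (\<lambda>i. G (x i))" and ?R2 = "range (\<lambda>i. H (y i))"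
  have "strict_mono (\<lambda>i. G (x i))" "strict_mono (\<lambda>i. H (y i))"
    using interleaved_strict_mono[of "\<lambda>i. G (x i)" "\<lambda>i. H (y i)"] xy by blast+
  then have "infinite ?R1" "infinite ?R2"
    using range_inj_infinite strict_mono_imp_inj_on by blast+
  moreover have "inj_on f (tri c ?R1 ?R2)"
  proof -
    have "(x i, y j) \<in> tri c S1 S2" if "(G (x i), H (y j)) \<in> tri c ?R1 ?R2" for i j
      using that unfolding mem_tri interleaved_less_iff[of x y, OF xy(3,4)]
        interleaved_less_iff[of "\<lambda>i. G (x i)" "\<lambda>i. H (y i)", OF xy(5,6)]
      using xy(1,2) by (simp add: U1_def U2_def)
    moreover have "\<exists>i j. p = (G (x i), H (y j))" if "p \<in> tri c ?R1 ?R2" for p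
      using that by (cases p) (auto simp: mem_tri)
    ultimately show ?thesis
      by (intro inj_onI) (metis (no_types, lifting) inj_onD[OF inj] case_prod_conv prod.inject)
  qed
  ultimately show ?thesis by blast
qed


section \<open>Polymorphisms of \<open>T2\<close> and \<open>T1 \<inter> T2\<close>\<close>

definition op2 :: "(nat \<times> nat \<Rightarrow> nat) \<Rightarrow> nat list \<Rightarrow> nat" where
  "op2 g = (\<lambda>xs\<in>tuples 2. g (xs ! 0, xs ! 1))"

lemma pair_in_tuples [simp]: "[x, y] \<in> tuples 2"
  by (simp add: tuples_def)

lemma tuples_2_iff: "xs \<in> tuples 2 \<longleftrightarrow> (\<exists>x y. xs = [x, y])"
  by (auto simp: tuples_def length_Suc_conv numeral_2_eq_2)

lemma op2_pair [simp]: "op2 g [x, y] = g (x, y)"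
  by (simp add: op2_def)

lemma op2_in_space [simp]: "op2 g \<in> tuples 2 \<rightarrow>\<^sub>E UNIV"
  by (auto simp: op2_def)

lemma op2_in_T1_iff: "op2 g \<in> T1 \<longleftrightarrow> almost_unary g"
  by (simp add: T1_def)

lemma op2_in_T2_iff: "op2 g \<in> T2 \<longleftrightarrow> nowhere_injective g"
  by (simp add: T2_def)

lemma comp_op_pair [simp]: "comp_op f gs [x, y] = f (map (\<lambda>g. g [x, y]) gs)"
  by (simp add: comp_op_def)

lemma comp_op_in_space [simp]: "comp_op f gs \<in> tuples 2 \<rightarrow>\<^sub>E UNIV"
  by (auto simp: comp_op_def)

section \<open>Witnesses against being a polymorphism\<close>

lemma not_almost_unary_iff:
  "\<not> almost_unary h \<longleftrightarrow> (\<exists>x. \<forall>b. \<exists>y. b < h (x, y)) \<and> (\<exists>y. \<forall>b. \<exists>x. b < h (x, y))"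
proof -
  have "(\<exists>F. \<forall>x y. h (x, y) \<le> F x) \<longleftrightarrow> (\<forall>x. \<exists>b. \<forall>y. h (x, y) \<le> b)" by metis
  moreover have "(\<exists>F. \<forall>x y. h (x, y) \<le> F y) \<longleftrightarrow> (\<forall>y. \<exists>b. \<forall>x. h (x, y) \<le> b)" by metis
  ultimately show ?thesis unfolding almost_unary_def by (simp add: not_le)
qed

definition unary_witness ::
  "nat \<Rightarrow> (nat list \<Rightarrow> nat) \<Rightarrow> bool \<Rightarrow> nat set \<Rightarrow> nat set \<Rightarrow> (nat \<Rightarrow> bool) \<Rightarrow> (nat \<Rightarrow> nat \<Rightarrow> nat) \<Rightarrow> bool" where
  "unary_witness k f c S1 S2 e G \<longleftrightarrow> infinite S1 \<and> infinite S2 \<and>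
     inj_on (\<lambda>(x, y). f (map (\<lambda>m. G m (if e m then x else y)) [0..<k])) (tri c S1 S2)"

definition inj_after_unary :: "nat \<Rightarrow> (nat list \<Rightarrow> nat) \<Rightarrow> bool" where
  "inj_after_unary k f \<longleftrightarrow> (\<exists>c S1 S2 e G. unary_witness k f c S1 S2 e G)"

text \<open>Only the values of \<open>g\<close> on row \<open>x0\<close> and column
  \<open>y0\<close> matter. \<open>e m\<close> records on which of these two lines the
  \<open>m\<close>-th argument is bounded; being bounded on one of them is all that remains of being
  almost unary.\<close>

definition cross_witness ::
  "nat \<Rightarrow> (nat list \<Rightarrow> nat) \<Rightarrow> nat \<Rightarrow> nat \<Rightarrow> (nat \<Rightarrow> bool) \<Rightarrow> (nat \<Rightarrow> nat) \<Rightarrow> (nat \<Rightarrow> nat \<Rightarrow> nat \<Rightarrow> nat) \<Rightarrow> bool" where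
  "cross_witness k f x0 y0 e B g \<longleftrightarrow>
     (\<forall>m<k. if e m then \<forall>y. g m x0 y \<le> B m else \<forall>x. g m x y0 \<le> B m) \<and>
     (\<forall>b. \<exists>y. b < f (map (\<lambda>m. g m x0 y) [0..<k])) \<and>
     (\<forall>b. \<exists>x. b < f (map (\<lambda>m. g m x y0) [0..<k]))"

definition unbounded_on_cross :: "nat \<Rightarrow> (nat list \<Rightarrow> nat) \<Rightarrow> bool" where
  "unbounded_on_cross k f \<longleftrightarrow> (\<exists>x0 y0 e B g. cross_witness k f x0 y0 e B g)"

lemma upt_0_2: "[0..<2] = [0, 1 :: nat]"
  by (simp add: upt_rec)

lemma bchoice_two:
  fixes n :: nat
  assumes "\<And>m. m < n \<Longrightarrow> \<exists>u v. Q m u v"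
  shows "\<exists>u v. \<forall>m<n. Q m (u m) (v m)"
  using assms by metis

lemma inj_after_unaryI:
  assumes gs: "set gs \<subseteq> T2" and n: "comp_op f gs \<notin> T2"
  shows "inj_after_unary (length gs) f"
proof -
  have "\<not> nowhere_injective (\<lambda>(x, y). comp_op f gs [x, y])" using n by (simp add: T2_def)
  then obtain c S1 S2 where S: "infinite S1" "infinite S2"
    and inj: "inj_on (\<lambda>(x, y). comp_op f gs [x, y]) (tri c S1 S2)"
    unfolding nowhere_injective_iff by blast
  have "\<forall>h\<in>set (map (\<lambda>g (x, y). g [x, y]) gs). nowhere_injective h"
    using gs by (auto simp: T2_def)
  from ex_unary_on_list[OF this S] obtain S1' S2' where S': "S1' \<subseteq> S1" "S2' \<subseteq> S2"
    "infinite S1'" "infinite S2'"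
    and "\<forall>h\<in>set (map (\<lambda>g (x, y). g [x, y]) gs). unary_on (tri c S1' S2') h" by blast
  then have "\<forall>g\<in>set gs. \<exists>e G. \<forall>(x, y)\<in>tri c S1' S2'. g [x, y] = G (if e then x else y)"
    by (simp add: unary_on_def)
  then have "\<exists>e G. \<forall>m<length gs. \<forall>(x, y)\<in>tri c S1' S2'. (gs ! m) [x, y] = G m (if e m then x else y)"
    by (intro bchoice_two) simp
  then obtain e G where eG': "\<forall>m<length gs. \<forall>(x, y)\<in>tri c S1' S2'. (gs ! m) [x, y] = G m (if e m then x else y)"
    by (elim exE)
  have eG: "(gs ! m) [x, y] = G m (if e m then x else y)"
    if "m < length gs" "(x, y) \<in> tri c S1' S2'" for m x y
    using eG' that by blast
  have "map (\<lambda>m. G m (if e m then x else y)) [0..<length gs] = map (\<lambda>g. g [x, y]) gs"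
    if "(x, y) \<in> tri c S1' S2'" for x y
    using eG[OF _ that] by (intro nth_equalityI) auto
  moreover have "inj_on (\<lambda>(x, y). comp_op f gs [x, y]) (tri c S1' S2')"
    by (rule inj_on_subset[OF inj], rule tri_mono) (use S' in auto)
  ultimately have "inj_on (\<lambda>(x, y). f (map (\<lambda>m. G m (if e m then x else y)) [0..<length gs])) (tri c S1' S2')"
    by (subst inj_on_cong[where g = "\<lambda>(x, y). comp_op f gs [x, y]"]) auto
  then have "unary_witness (length gs) f c S1' S2' e G" using S' by (simp add: unary_witness_def)
  then show ?thesis unfolding inj_after_unary_def by blast
qed

text \<open>The extended arguments lie in \<open>T1\<close> as well and the composition leaves
  \<open>T2\<close>, so the same tuple refutes membership in either clone.\<close>

lemma inj_after_unaryE: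
  assumes "inj_after_unary k f"
  obtains gs where "length gs = k" "set gs \<subseteq> T1 \<inter> T2" "comp_op f gs \<notin> T2"
proof -
  obtain c S1 S2 e G where "unary_witness k f c S1 S2 e G"
    using assms unfolding inj_after_unary_def by blast
  then have S: "infinite S1" "infinite S2"
    and inj: "inj_on (\<lambda>(x, y). f (map (\<lambda>m. G m (if e m then x else y)) [0..<k])) (tri c S1 S2)"
    unfolding unary_witness_def by simp_all
  define h where "h m = (\<lambda>(x, y). if (x, y) \<in> tri c S1 S2 then G m (if e m then x else y) else 0)" for m
  have "nowhere_injective (h m)" for m
    by (rule nowhere_injective_unary_on[of "tri c S1 S2"]) (auto simp: h_def unary_on_def)
  moreover have "almost_unary (h m)" for m
  proof (cases "e m")
    case True
    then show ?thesis unfolding almost_unary_def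
      by (intro disjI1 exI[of _ "G m"]) (simp add: h_def)
  next
    case False
    then show ?thesis unfolding almost_unary_def
      by (intro disjI2 exI[of _ "G m"]) (simp add: h_def)
  qed
  ultimately have hT: "op2 (h m) \<in> T1 \<inter> T2" for m
    by (simp add: op2_in_T1_iff op2_in_T2_iff)
  define gs where "gs = map (\<lambda>m. op2 (h m)) [0..<k]"
  have "inj_on (\<lambda>(x, y). comp_op f gs [x, y]) (tri c S1 S2)"
    by (subst inj_on_cong[where g = "\<lambda>(x, y). f (map (\<lambda>m. G m (if e m then x else y)) [0..<k])"])
      (auto simp: gs_def h_def comp_def inj split: prod.splits)
  then have "comp_op f gs \<notin> T2"
    using S by (auto simp: T2_def nowhere_injective_iff)
  moreover have "length gs = k" "set gs \<subseteq> T1 \<inter> T2" using hT by (auto simp: gs_def)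
  ultimately show ?thesis using that by blast
qed

lemma unbounded_on_crossI:
  assumes gs: "set gs \<subseteq> T1" and n: "comp_op f gs \<notin> T1"
  shows "unbounded_on_cross (length gs) f"
proof -
  have "\<not> almost_unary (\<lambda>(x, y). comp_op f gs [x, y])" using n by (simp add: T1_def)
  then obtain x0 y0 where ub: "\<forall>b. \<exists>y. b < comp_op f gs [x0, y]" "\<forall>b. \<exists>x. b < comp_op f gs [x, y0]"
    unfolding not_almost_unary_iff by auto
  have "\<exists>e B. if e then \<forall>y. (gs ! m) [x0, y] \<le> B else \<forall>x. (gs ! m) [x, y0] \<le> B"
    if "m < length gs" for m
  proof -
    have "almost_unary (\<lambda>(x, y). (gs ! m) [x, y])" using gs nth_mem[OF that] unfolding T1_def by blast
    then consider F where "\<forall>x y. (gs ! m) [x, y] \<le> F x" | F where "\<forall>x y. (gs ! m) [x, y] \<le> F y"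
      unfolding almost_unary_def by auto
    then show ?thesis by cases (metis (full_types))+
  qed
  then have "\<exists>e B. \<forall>m<length gs. if e m then \<forall>y. (gs ! m) [x0, y] \<le> B m else \<forall>x. (gs ! m) [x, y0] \<le> B m"
    by (rule bchoice_two)
  then obtain e B where eB: "\<forall>m<length gs. if e m then \<forall>y. (gs ! m) [x0, y] \<le> B m else \<forall>x. (gs ! m) [x, y0] \<le> B m"
    by (elim exE)
  have "comp_op f gs [x, y] = f (map (\<lambda>m. (gs ! m) [x, y]) [0..<length gs])" for x y
    using nth_equalityI[of "map (\<lambda>g. g [x, y]) gs" "map (\<lambda>m. (gs ! m) [x, y]) [0..<length gs]"]
    by simp
  then have "cross_witness (length gs) f x0 y0 e B (\<lambda>m x y. (gs ! m) [x, y])"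
    using ub eB by (simp add: cross_witness_def del: comp_op_pair)
  then show ?thesis unfolding unbounded_on_cross_def by blast
qed

lemma unbounded_on_crossE:
  assumes "unbounded_on_cross k f"
  obtains gs where "length gs = k" "set gs \<subseteq> T1 \<inter> T2" "comp_op f gs \<notin> T1"
proof -
  obtain x0 y0 e B g where "cross_witness k f x0 y0 e B g"
    using assms unfolding unbounded_on_cross_def by blast
  then have B: "\<And>m. m < k \<Longrightarrow> if e m then \<forall>y. g m x0 y \<le> B m else \<forall>x. g m x y0 \<le> B m"
    and ub: "\<forall>b. \<exists>y. b < f (map (\<lambda>m. g m x0 y) [0..<k])"
      "\<forall>b. \<exists>x. b < f (map (\<lambda>m. g m x y0) [0..<k])"
    unfolding cross_witness_def by simp_all
  define h where "h m = (\<lambda>(x, y). if x = x0 \<or> y = y0 then g m x y else 0)" for m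
  have "nowhere_injective (h m)" for m
    by (rule nowhere_injective_cross[of x0 y0]) (simp add: h_def)
  moreover have "almost_unary (h m)" if "m < k" for m
  proof (cases "e m")
    case True
    then show ?thesis unfolding almost_unary_def using B[OF that]
      by (intro disjI1 exI[of _ "\<lambda>x. if x = x0 then B m else g m x y0"]) (simp add: h_def)
  next
    case False
    then show ?thesis unfolding almost_unary_def using B[OF that]
      by (intro disjI2 exI[of _ "\<lambda>y. if y = y0 then B m else g m x0 y"]) (simp add: h_def)
  qed
  ultimately have hT: "op2 (h m) \<in> T1 \<inter> T2" if "m < k" for m
    using that by (simp add: op2_in_T1_iff op2_in_T2_iff)
  define gs where "gs = map (\<lambda>m. op2 (h m)) [0..<k]"
  have "comp_op f gs [x0, y] = f (map (\<lambda>m. g m x0 y) [0..<k])"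
    "comp_op f gs [x, y0] = f (map (\<lambda>m. g m x y0) [0..<k])" for x y
    by (simp_all add: gs_def h_def comp_def)
  then have "\<forall>b. \<exists>y. b < comp_op f gs [x0, y]" "\<forall>b. \<exists>x. b < comp_op f gs [x, y0]"
    using ub by (simp_all del: comp_op_pair)
  then have "\<not> almost_unary (\<lambda>(x, y). comp_op f gs [x, y])"
    unfolding not_almost_unary_iff prod.case by blast
  then have "comp_op f gs \<notin> T1" by (simp add: T1_def)
  moreover have "length gs = k" "set gs \<subseteq> T1 \<inter> T2" using hT by (auto simp: gs_def)
  ultimately show ?thesis using that by blast
qed

lemma Pol_T2_iff:
  "(k, f) \<in> Pol T2 \<longleftrightarrow> (k, f) \<in> topspace all_op_space \<and> \<not> inj_after_unary k f"
proof -
  have "(\<forall>gs. length gs = k \<and> set gs \<subseteq> T2 \<longrightarrow> comp_op f gs \<in> T2) \<longleftrightarrow> \<not> inj_after_unary k f"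
    using inj_after_unaryI[of _ f] inj_after_unaryE[of k f] by (metis le_inf_iff)
  then show ?thesis unfolding Pol_def by auto
qed

lemma Pol_T1_T2_iff:
  "(k, f) \<in> Pol (T1 \<inter> T2) \<longleftrightarrow>
     (k, f) \<in> topspace all_op_space \<and> \<not> (inj_after_unary k f \<or> unbounded_on_cross k f)"
proof -
  have "(\<forall>gs. length gs = k \<and> set gs \<subseteq> T1 \<inter> T2 \<longrightarrow> comp_op f gs \<in> T1 \<inter> T2) \<longleftrightarrow>
      \<not> (inj_after_unary k f \<or> unbounded_on_cross k f)"
    using inj_after_unaryI[of _ f] inj_after_unaryE[of k f]
      unbounded_on_crossI[of _ f] unbounded_on_crossE[of k f] by (metis Int_iff le_inf_iff)
  then show ?thesis unfolding Pol_def by auto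
qed

section \<open>Binary parts of the two clones\<close>

lemma projections_in_T1_T2:
  "op2 fst \<in> T1 \<inter> T2" "op2 snd \<in> T1 \<inter> T2"
proof -
  have "unary_on UNIV fst" "unary_on UNIV snd"
    unfolding unary_on_def by (rule exI[of _ True], force, rule exI[of _ False], force)
  then have "nowhere_injective fst" "nowhere_injective snd"
    using nowhere_injective_unary_on by blast+
  moreover have "almost_unary fst" "almost_unary snd"
    unfolding almost_unary_def by (auto intro: exI[of _ "\<lambda>x. x"])
  ultimately show "op2 fst \<in> T1 \<inter> T2" "op2 snd \<in> T1 \<inter> T2"
    by (simp_all add: op2_in_T1_iff op2_in_T2_iff)
qed

text \<open>\<open>f\<close> is its own composition with the two projections.\<close>

lemma binary_Pol_imp:
  assumes "(2, f) \<in> Pol B" "op2 fst \<in> B" "op2 snd \<in> B"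
  shows "f \<in> B"
proof -
  have f: "f \<in> tuples 2 \<rightarrow>\<^sub>E UNIV" using assms(1) by (simp add: Pol_def)
  have "comp_op f [op2 fst, op2 snd] \<in> B" using assms by (auto simp: Pol_def)
  moreover have "comp_op f [op2 fst, op2 snd] = f"
    by (rule PiE_ext[OF comp_op_in_space f]) (auto simp: tuples_2_iff)
  ultimately show ?thesis by simp
qed

text \<open>If both inner functions read the same coordinate, the composition agrees on two vertices
  of a rectangle that share it. Otherwise \<open>inj_on_tri_unary_args\<close> yields a triangle on
  which \<open>f\<close> itself is injective.\<close>

lemma binary_not_inj_after_unary:
  assumes f: "f \<in> T2"
  shows "\<not> inj_after_unary 2 f"
proof
  let ?f = "\<lambda>(x, y). f [x, y]"
  assume "inj_after_unary 2 f"
  then obtain c S1 S2 e G where "unary_witness 2 f c S1 S2 e G"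
    unfolding inj_after_unary_def by blast
  then have S: "infinite S1" "infinite S2"
    and inj: "inj_on (\<lambda>(x, y). f [G 0 (if e 0 then x else y), G 1 (if e 1 then x else y)]) (tri c S1 S2)"
    unfolding unary_witness_def upt_0_2 list.map by simp_all
  have none: "\<not> inj_on ?f (tri c S1 S2)" if "infinite S1" "infinite S2" for c S1 S2
    using that f by (simp add: T2_def nowhere_injective_iff)
  obtain x x' y y' where r: "x \<noteq> x'" "y \<noteq> y'" "{x, x'} \<times> {y, y'} \<subseteq> tri c S1 S2"
    using ex_rectangle[OF S] by blast
  then have mem: "(x, y) \<in> tri c S1 S2" "(x', y) \<in> tri c S1 S2" "(x, y') \<in> tri c S1 S2" by auto
  consider "e 0" "e 1" | "\<not> e 0" "\<not> e 1" | "e 0" "\<not> e 1" | "\<not> e 0" "e 1" by blast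
  then show False
  proof cases
    case 1
    then show False using inj_onD[OF inj _ mem(1,3)] r by simp
  next
    case 2
    then show False using inj_onD[OF inj _ mem(1,2)] r by simp
  next
    case 3
    then have "inj_on (\<lambda>(x, y). ?f (G 0 x, G 1 y)) (tri c S1 S2)" using inj by simp
    then show False using inj_on_tri_unary_args[OF S, of ?f "G 0" "G 1" c] none by blast
  next
    case 4
    \<comment> \<open>Here the first argument of \<open>f\<close> reads \<open>y\<close> and the
      second reads \<open>x\<close>, so the transposed operation is treated and the triangle is
      reflected back.\<close>
    let ?f' = "\<lambda>(x, y). ?f (y, x)"
    have "inj_on (\<lambda>(x, y). ?f' (G 1 x, G 0 y)) (tri c S1 S2)" using 4 inj by simp
    then obtain c S1 S2 where S: "infinite S1" "infinite S2" and "inj_on ?f' (tri c S1 S2)"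
      using inj_on_tri_unary_args[OF S, of ?f' "G 1" "G 0" c] by blast
    then have "inj_on ?f (tri (\<not> c) S2 S1)" using inj_on_tri_swap[of ?f c S1 S2] by simp
    then show False using none S by blast
  qed
qed

text \<open>\<open>f\<close> is bounded by a function \<open>F\<close> of its \<open>m\<close>-th
  argument, and that argument is at most \<open>B m\<close> on the row or on the column. There
  \<open>f\<close> is bounded by the largest value of \<open>F\<close> on
  \<open>{..B m}\<close>.\<close>

lemma binary_not_unbounded_on_cross:
  assumes f: "f \<in> T1"
  shows "\<not> unbounded_on_cross 2 f"
proof
  assume "unbounded_on_cross 2 f"
  then obtain x0 y0 e B g where "cross_witness 2 f x0 y0 e B g"
    unfolding unbounded_on_cross_def by blast
  then have B: "\<forall>m<2. if e m then \<forall>y. g m x0 y \<le> B m else \<forall>x. g m x y0 \<le> B m"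
    and ub: "\<forall>b. \<exists>y. b < f [g 0 x0 y, g 1 x0 y]" "\<forall>b. \<exists>x. b < f [g 0 x y0, g 1 x y0]"
    unfolding cross_witness_def upt_0_2 list.map by simp_all
  from f have "almost_unary (\<lambda>(x, y). f [x, y])" by (simp add: T1_def)
  then obtain F and m :: nat where m: "m < 2" and F: "\<And>x y. f [x, y] \<le> F ([x, y] ! m)"
    unfolding almost_unary_def
  proof (elim disjE exE)
    fix F assume "\<forall>x y. (case (x, y) of (x, y) \<Rightarrow> f [x, y]) \<le> F x"
    then show ?thesis by (intro that[of 0 F]) auto
  next
    fix F assume "\<forall>x y. (case (x, y) of (x, y) \<Rightarrow> f [x, y]) \<le> F y"
    then show ?thesis by (intro that[of 1 F]) auto
  qed
  define b where "b = Max (F ` {..B m})"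
  have b: "F n \<le> b" if "n \<le> B m" for n unfolding b_def using that by (intro Max_ge) auto
  have nth: "[g 0 x y, g 1 x y] ! m = g m x y" for x y using m by (cases m) auto
  have le: "f [g 0 x y, g 1 x y] \<le> b" if "g m x y \<le> B m" for x y
    using F[of "g 0 x y" "g 1 x y"] b[OF that] unfolding nth by simp
  show False
  proof (cases "e m")
    case True
    then show False using B m le ub(1) by (metis not_le)
  next
    case False
    then show False using B m le ub(2) by (metis not_le)
  qed
qed

lemma binary_Pol_T2_iff: "(2, f) \<in> Pol T2 \<longleftrightarrow> f \<in> T2"
proof
  show "f \<in> T2" if "(2, f) \<in> Pol T2"
    using binary_Pol_imp[OF that] projections_in_T1_T2 by blast
  show "(2, f) \<in> Pol T2" if "f \<in> T2"
    using binary_not_inj_after_unary[OF that] that by (simp add: Pol_T2_iff) (simp add: T2_def)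
qed

lemma binary_Pol_T1_T2_iff: "(2, f) \<in> Pol (T1 \<inter> T2) \<longleftrightarrow> f \<in> T1 \<inter> T2"
proof
  show "f \<in> T1 \<inter> T2" if "(2, f) \<in> Pol (T1 \<inter> T2)"
    using binary_Pol_imp[OF that] projections_in_T1_T2 by blast
  show "(2, f) \<in> Pol (T1 \<inter> T2)" if "f \<in> T1 \<inter> T2"
    using that binary_not_inj_after_unary binary_not_unbounded_on_cross
    by (simp add: Pol_T1_T2_iff) (simp add: T2_def)
qed


section \<open>Analytic sets\<close>

lemma topspace_baire_space [simp]: "topspace baire_space = UNIV"
  by (simp add: baire_space_def)

lemma continuous_map_baire_coordinate:
  "continuous_map baire_space (discrete_topology UNIV) (\<lambda>z. z i)"
  using continuous_map_product_projection[of i UNIV "\<lambda>_. discrete_topology UNIV"]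
  by (simp add: baire_space_def)

lemma continuous_map_discreteI:
  assumes "\<And>x. x \<in> topspace X \<Longrightarrow> \<exists>U. openin X U \<and> x \<in> U \<and> (\<forall>y\<in>U. g y = g x)"
  shows "continuous_map X (discrete_topology UNIV) g"
  unfolding continuous_map_def
proof (intro conjI allI impI)
  fix V
  show "openin X {x \<in> topspace X. g x \<in> V}"
  proof (subst openin_subopen, safe)
    fix x assume x: "x \<in> topspace X" "g x \<in> V"
    obtain U where "openin X U" "x \<in> U" "\<forall>y\<in>U. g y = g x" using assms[OF x(1)] by blast
    then show "\<exists>T. openin X T \<and> x \<in> T \<and> T \<subseteq> {x \<in> topspace X. g x \<in> V}"
      using x openin_subset by (intro exI[of _ U]) fastforce
  qed
qed simp

lemma openin_agree:
  fixes e :: "nat \<Rightarrow> 'a \<Rightarrow> 'b"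
  assumes "\<And>i. continuous_map X (discrete_topology UNIV) (e i)"
  shows "openin X {y \<in> topspace X. \<forall>i<n. e i y = e i x}"
proof (induction n)
  case (Suc n)
  have "openin X {y \<in> topspace X. e n y \<in> {e n x}}"
    by (rule openin_continuous_map_preimage[OF assms]) simp
  then have "openin X ({y \<in> topspace X. \<forall>i<n. e i y = e i x} \<inter> {y \<in> topspace X. e n y \<in> {e n x}})"
    using Suc by blast
  moreover have "{y \<in> topspace X. \<forall>i<Suc n. e i y = e i x} =
      {y \<in> topspace X. \<forall>i<n. e i y = e i x} \<inter> {y \<in> topspace X. e n y \<in> {e n x}}"
    by (auto simp: less_Suc_eq)
  ultimately show ?case by simp
qed simp

text \<open>Continuity into a discrete space, in a form whose closure rules let the coded conditions
  be checked by their syntax.\<close>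

definition fin_det :: "((nat \<Rightarrow> nat) \<Rightarrow> 'b) \<Rightarrow> bool" where
  "fin_det g \<longleftrightarrow> (\<forall>z. \<exists>n. \<forall>w. (\<forall>i<n. w i = z i) \<longrightarrow> g w = g z)"

lemma fin_det_iff_continuous:
  "fin_det g \<longleftrightarrow> continuous_map baire_space (discrete_topology UNIV) g"
proof
  assume g: "fin_det g"
  show "continuous_map baire_space (discrete_topology UNIV) g"
  proof (rule continuous_map_discreteI)
    fix z
    obtain n where n: "\<forall>w. (\<forall>i<n. w i = z i) \<longrightarrow> g w = g z" using g unfolding fin_det_def by blast
    have "openin baire_space {y \<in> topspace baire_space. \<forall>i<n. y i = z i}"
      by (rule openin_agree) (rule continuous_map_baire_coordinate)
    moreover have "\<forall>y\<in>{y \<in> topspace baire_space. \<forall>i<n. y i = z i}. g y = g z"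
      using n by blast
    ultimately show "\<exists>U. openin baire_space U \<and> z \<in> U \<and> (\<forall>y\<in>U. g y = g z)"
      by (intro exI[of _ "{y \<in> topspace baire_space. \<forall>i<n. y i = z i}"] conjI) (assumption | simp)+
  qed
next
  assume g: "continuous_map baire_space (discrete_topology UNIV) g"
  show "fin_det g"
    unfolding fin_det_def
  proof
    fix z
    have "openin baire_space {w \<in> topspace baire_space. g w \<in> {g z}}"
      by (rule openin_continuous_map_preimage[OF g]) simp
    then obtain U where U: "finite {i. U i \<noteq> (UNIV :: nat set)}" "z \<in> Pi\<^sub>E UNIV U"
      "Pi\<^sub>E UNIV U \<subseteq> {w. g w = g z}"
      unfolding baire_space_def openin_product_topology_alt by auto
    then obtain n where n: "{i. U i \<noteq> UNIV} \<subseteq> {..<n}" using finite_nat_iff_bounded by blast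
    have "g w = g z" if "\<forall>i<n. w i = z i" for w
    proof -
      have "w i \<in> U i" for i
        using that U(2) n by (cases "i < n") (auto dest: PiE_mem)
      then show ?thesis using U(3) by blast
    qed
    then show "\<exists>n. \<forall>w. (\<forall>i<n. w i = z i) \<longrightarrow> g w = g z" by blast
  qed
qed

lemma fin_det_const: "fin_det (\<lambda>z. c)"
  by (simp add: fin_det_def)

lemma fin_det_comp2:
  assumes "fin_det g" "fin_det h"
  shows "fin_det (\<lambda>z. k (g z) (h z))"
  unfolding fin_det_def
proof
  fix z
  obtain m n where "\<forall>w. (\<forall>i<m. w i = z i) \<longrightarrow> g w = g z" "\<forall>w. (\<forall>i<n. w i = z i) \<longrightarrow> h w = h z"
    using assms unfolding fin_det_def by meson
  then have "\<forall>w. (\<forall>i<max m n. w i = z i) \<longrightarrow> k (g w) (h w) = k (g z) (h z)"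
    by (metis less_max_iff_disj)
  then show "\<exists>n. \<forall>w. (\<forall>i<n. w i = z i) \<longrightarrow> k (g w) (h w) = k (g z) (h z)" by blast
qed

lemma fin_det_comp: "fin_det g \<Longrightarrow> fin_det (\<lambda>z. k (g z))"
  using fin_det_comp2[of g g "\<lambda>a b. k a"] by simp

lemma fin_det_eval:
  assumes "fin_det g"
  shows "fin_det (\<lambda>z. z (g z))"
  unfolding fin_det_def
proof
  fix z
  obtain n where "\<forall>w. (\<forall>i<n. w i = z i) \<longrightarrow> g w = g z" using assms unfolding fin_det_def by blast
  then have "\<forall>w. (\<forall>i<max n (Suc (g z)). w i = z i) \<longrightarrow> w (g w) = z (g z)"
    by (metis less_max_iff_disj lessI)
  then show "\<exists>n. \<forall>w. (\<forall>i<n. w i = z i) \<longrightarrow> w (g w) = z (g z)" by blast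
qed

lemma fin_det_map_upt_fixed:
  assumes "\<And>m. fin_det (g m)"
  shows "fin_det (\<lambda>z. map (\<lambda>m. g m z) [0..<n])"
proof (induction n)
  case (Suc n)
  have "fin_det (\<lambda>z. map (\<lambda>m. g m z) [0..<n] @ [g n z])"
    by (rule fin_det_comp2[OF Suc, of "g n" "\<lambda>a b. a @ [b]"]) (rule assms)
  then show ?case by simp
qed (simp add: fin_det_const)

lemma fin_det_select:
  assumes "fin_det k" "\<And>n. fin_det (g n)"
  shows "fin_det (\<lambda>z. g (k z) z)"
  unfolding fin_det_def
proof
  fix z
  obtain m n where "\<forall>w. (\<forall>i<m. w i = z i) \<longrightarrow> k w = k z"
    "\<forall>w. (\<forall>i<n. w i = z i) \<longrightarrow> g (k z) w = g (k z) z"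
    using assms unfolding fin_det_def by meson
  then have "\<forall>w. (\<forall>i<max m n. w i = z i) \<longrightarrow> g (k w) w = g (k z) z"
    by (metis less_max_iff_disj)
  then show "\<exists>n. \<forall>w. (\<forall>i<n. w i = z i) \<longrightarrow> g (k w) w = g (k z) z" by blast
qed

lemma fin_det_map_upt:
  assumes "fin_det k" "\<And>m. fin_det (g m)"
  shows "fin_det (\<lambda>z. map (\<lambda>m. g m z) [0..<k z])"
  by (rule fin_det_select[OF assms(1)]) (rule fin_det_map_upt_fixed[OF assms(2)])

text \<open>A point of the Baire space codes countably many operations of arbitrary arities.\<close>
definition cell :: "(nat \<Rightarrow> nat) \<Rightarrow> nat \<Rightarrow> nat list \<Rightarrow> nat" where
  "cell z t xs = z (prod_encode (t, list_encode xs))"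

lemma cell_surj: "\<exists>z. cell z = p"
proof
  show "cell (\<lambda>n. p (fst (prod_decode n)) (list_decode (snd (prod_decode n)))) = p"
    by (intro ext) (simp add: cell_def)
qed

lemma fin_det_cell: "fin_det xs \<Longrightarrow> fin_det (\<lambda>z. cell z t (xs z))"
  unfolding cell_def by (intro fin_det_eval fin_det_comp[of xs "\<lambda>x. prod_encode (t, list_encode x)"])

lemmas fin_det_intros =
  fin_det_const fin_det_cell fin_det_map_upt
  fin_det_comp2[of _ _ "(<)"] fin_det_comp2[of _ _ "(\<le>)"] fin_det_comp2[of _ _ "(=)"]
  fin_det_comp2[of _ _ "(\<and>)"] fin_det_comp2[of _ _ "(\<longrightarrow>)"] fin_det_comp2[of _ _ "(#)"]
  fin_det_comp[of _ Suc]

lemma fin_det_if: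
  assumes "fin_det b" "fin_det g" "fin_det h"
  shows "fin_det (\<lambda>z. if b z then g z else h z)"
  using fin_det_comp2[OF assms(1) fin_det_comp2[OF assms(2,3), of Pair], of "\<lambda>b p. if b then fst p else snd p"]
  by (simp only: fst_conv snd_conv)

text \<open>\<open>r z\<close> copies \<open>z\<close> as long as the word built so far still
  extends to a point of \<open>K\<close>, and otherwise picks a letter that keeps it extendible.
  Closedness puts the limit into \<open>K\<close>, and points of \<open>K\<close> are never
  altered.\<close>

lemma retraction_onto_closed:
  fixes K :: "(nat \<Rightarrow> nat) set"
  assumes K: "K \<noteq> {}" and closed: "\<And>z. (\<And>n. \<exists>w\<in>K. \<forall>i<n. w i = z i) \<Longrightarrow> z \<in> K"
  obtains r where "continuous_map baire_space baire_space r" "range r = K"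
proof -
  define ext where "ext s \<longleftrightarrow> (\<exists>w\<in>K. \<forall>i<length s. w i = s ! i)" for s
  define g where "g = (\<lambda>z. rec_nat [] (\<lambda>n s. s @ [if ext (s @ [z n]) then z n else (SOME c. ext (s @ [c]))]))"
  have g0: "g z 0 = []" for z by (simp add: g_def)
  have gS: "g z (Suc n) = g z n @ [if ext (g z n @ [z n]) then z n else (SOME c. ext (g z n @ [c]))]" for z n
    by (simp add: g_def)
  have len: "length (g z n) = n" for z n by (induction n) (simp_all add: g0 gS)
  define r where "r z n = g z (Suc n) ! n" for z n
  have nth: "i < n \<Longrightarrow> g z n ! i = r z i" for z n i
    by (induction n) (auto simp: gS r_def nth_append len less_Suc_eq)
  have ext_Suc: "\<exists>c. ext (s @ [c])" if s: "ext s" for s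
  proof -
    obtain w where "w \<in> K" "\<forall>i<length s. w i = s ! i" using s unfolding ext_def by blast
    then have "ext (s @ [w (length s)])"
      unfolding ext_def by (intro bexI[of _ w]) (auto simp: nth_append less_Suc_eq)
    then show ?thesis ..
  qed
  have ext: "ext (g z n)" for z n
  proof (induction n)
    case 0
    then show ?case using K by (auto simp: g0 ext_def)
  next
    case (Suc n)
    then show ?case using someI_ex[OF ext_Suc[OF Suc]] by (simp add: gS)
  qed
  have rK: "r z \<in> K" for z
  proof (rule closed)
    fix n
    obtain w where "w \<in> K" "\<forall>i<n. w i = g z n ! i" using ext[of z n] unfolding ext_def len by blast
    then show "\<exists>w\<in>K. \<forall>i<n. w i = r z i" using nth by auto
  qed
  have fixed: "r z = z" if "z \<in> K" for z
  proof -
    have "g z n = map z [0..<n]" for n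
    proof (induction n)
      case (Suc n)
      have "ext (map z [0..<n] @ [z n])"
        unfolding ext_def using that by (intro bexI[of _ z]) (auto simp: nth_append less_Suc_eq)
      then show ?case using Suc by (simp add: gS)
    qed (simp add: g0)
    then have "r z i = z i" for i unfolding r_def by (simp del: upt_Suc)
    then show ?thesis by blast
  qed
  have dep: "(\<forall>i<n. w i = z i) \<Longrightarrow> g w n = g z n" for w z n
    by (induction n) (auto simp: g0 gS)
  have "fin_det (\<lambda>z. r z n)" for n
    unfolding fin_det_def r_def by (metis dep)
  then have "continuous_map baire_space baire_space r"
    unfolding fin_det_iff_continuous by (subst baire_space_def) (simp add: continuous_map_componentwise_UNIV)
  moreover have "range r = K" using rK fixed by (auto simp: image_iff) (metis)
  ultimately show ?thesis by (rule that)
qed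

text \<open>The fibres of \<open>g\<close> form an open partition. It is used to let the arity vary
  with the code and to merge two parametrizations.\<close>

lemma continuous_map_glue:
  assumes "fin_det g" "\<And>n. continuous_map baire_space X (h n)"
  shows "continuous_map baire_space X (\<lambda>z. h (g z) z)"
  unfolding continuous_map_def
proof (intro conjI allI impI)
  show "(\<lambda>z. h (g z) z) \<in> topspace baire_space \<rightarrow> topspace X"
    using assms(2) by (auto simp: continuous_map_def)
next
  fix U assume U: "openin X U"
  have "openin baire_space {z \<in> topspace baire_space. g z \<in> {n}}" for n
    by (rule openin_continuous_map_preimage) (use assms(1) in \<open>auto simp: fin_det_iff_continuous\<close>)
  moreover have "openin baire_space {z \<in> topspace baire_space. h n z \<in> U}" for n
    by (rule openin_continuous_map_preimage[OF assms(2) U])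
  ultimately have "openin baire_space (\<Union>n. {z \<in> topspace baire_space. g z \<in> {n}} \<inter>
      {z \<in> topspace baire_space. h n z \<in> U})"
    by blast
  moreover have "{z \<in> topspace baire_space. h (g z) z \<in> U} =
      (\<Union>n. {z \<in> topspace baire_space. g z \<in> {n}} \<inter> {z \<in> topspace baire_space. h n z \<in> U})"
    by auto
  ultimately show "openin baire_space {z \<in> topspace baire_space. h (g z) z \<in> U}" by simp
qed

text \<open>With the arity stored as its predecessor, every point of the Baire space codes an
  operation of positive arity.\<close>

definition decode_op :: "(nat \<Rightarrow> nat) \<Rightarrow> nat \<times> (nat list \<Rightarrow> nat)" where
  "decode_op z = (Suc (cell z 1 []), \<lambda>xs\<in>tuples (Suc (cell z 1 [])). cell z 0 xs)"

lemma continuous_decode_op: "continuous_map baire_space all_op_space decode_op"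
proof -
  have "continuous_map baire_space (op_space n) (\<lambda>z. \<lambda>xs\<in>tuples n. cell z 0 xs)" for n
    unfolding op_space_def continuous_map_componentwise
    by (auto simp: fin_det_iff_continuous[symmetric] intro!: fin_det_intros)
  then have "continuous_map baire_space all_op_space ((\<lambda>f. (Suc n, f)) \<circ> (\<lambda>z. \<lambda>xs\<in>tuples (Suc n). cell z 0 xs))" for n
    unfolding all_op_space_def
    by (rule continuous_map_compose) (simp add: continuous_map_component_injection)
  from continuous_map_glue[OF _ this, of "\<lambda>z. cell z 1 []"]
  show ?thesis by (simp add: decode_op_def[abs_def] comp_def fin_det_intros)
qed

text \<open>The conditions \<open>P n\<close> cut out a closed set. A retraction onto it replaces
  the closed set by the whole Baire space, as \<open>analytic_in\<close> requires.\<close>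

lemma analytic_in_closed_image:
  assumes P: "\<And>n. fin_det (P n)" and \<psi>: "continuous_map baire_space X \<psi>"
  shows "analytic_in X (\<psi> ` {z. \<forall>n. P n z})"
proof (cases "{z. \<forall>n. P n z} = {}")
  case False
  have "z \<in> {z. \<forall>n. P n z}" if z: "\<And>n. \<exists>w\<in>{z. \<forall>n. P n z}. \<forall>i<n. w i = z i" for z
  proof safe
    fix n
    obtain m where "\<forall>w. (\<forall>i<m. w i = z i) \<longrightarrow> P n w = P n z" using P unfolding fin_det_def by blast
    then show "P n z" using z[of m] by blast
  qed
  then obtain r where r: "continuous_map baire_space baire_space r" "range r = {z. \<forall>n. P n z}"
    using retraction_onto_closed[OF False] by blast
  then show ?thesis
    using r unfolding analytic_in_def topspace_baire_space
    by (intro disjI2 exI[of _ "\<psi> \<circ> r"]) (metis continuous_map_compose[OF _ \<psi>] image_comp)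
qed (simp add: analytic_in_def)

lemma analytic_in_Un:
  assumes "analytic_in X A" "analytic_in X B"
  shows "analytic_in X (A \<union> B)"
proof (cases "A = {} \<or> B = {}")
  case True
  then show ?thesis using assms by auto
next
  case False
  obtain h1 h2 where h: "continuous_map baire_space X h1" "A = range h1" "continuous_map baire_space X h2" "B = range h2"
    using assms False by (auto simp: analytic_in_def)
  \<comment> \<open>The letter \<open>z 0\<close> chooses between the two maps, and the tail
    \<open>s z\<close> is the argument.\<close>
  define s where "s z = (\<lambda>i. z (Suc i))" for z :: "nat \<Rightarrow> nat"
  have s: "continuous_map baire_space baire_space s"
    by (subst (2) baire_space_def) (auto simp: continuous_map_componentwise_UNIV s_def fin_det_iff_continuous[symmetric]
      intro: fin_det_eval fin_det_const)
  define k where "k n = (if n = 0 then h1 else h2) \<circ> s" for n :: nat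
  have "continuous_map baire_space X (k n)" for n
    unfolding k_def using h continuous_map_compose[OF s] by (cases "n = 0") auto
  then have cont: "continuous_map baire_space X (\<lambda>z. k (z 0) z)"
    by (rule continuous_map_glue[rotated]) (intro fin_det_eval fin_det_const)
  have "range (\<lambda>z. k (z 0) z) = A \<union> B"
  proof (intro equalityI subsetI)
    fix x assume "x \<in> A \<union> B"
    then consider u where "x = h1 u" | u where "x = h2 u" using h by auto
    then show "x \<in> range (\<lambda>z. k (z 0) z)"
    proof cases
      case 1
      then have "x = (\<lambda>z. k (z 0) z) (case_nat 0 u)" by (simp add: k_def s_def)
      then show ?thesis by blast
    next
      case 2
      then have "x = (\<lambda>z. k (z 0) z) (case_nat 1 u)" by (simp add: k_def s_def)
      then show ?thesis by blast
    qed
  qed (use h in \<open>auto simp: k_def\<close>)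
  then show ?thesis unfolding analytic_in_def using cont by auto
qed

lemma analytic_in_binary:
  assumes A: "analytic_in all_op_space A"
  shows "analytic_in (op_space 2) {f. (2, f) \<in> A}"
proof (cases "{f. (2, f) \<in> A} = {}")
  case False
  then obtain f0 where f0: "(2, f0) \<in> A" by blast
  then obtain h where h: "continuous_map baire_space all_op_space h" "A = range h"
    using A by (auto simp: analytic_in_def)
  have A_sub: "A \<subseteq> topspace all_op_space" using h continuous_map_image_subset_topspace by fastforce
  then have f0': "f0 \<in> topspace (op_space 2)" using f0 by auto
  \<comment> \<open>All other arities are sent to \<open>f0\<close>, which already lies in the
    section, so they add nothing to the image.\<close>
  define \<rho> where "\<rho> = (\<lambda>(k, f). if k = (2 :: nat) then f else f0)"
  have "continuous_map all_op_space (op_space 2) \<rho>"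
    unfolding continuous_map_def
  proof (intro conjI allI impI)
    show "\<rho> \<in> topspace all_op_space \<rightarrow> topspace (op_space 2)"
      using f0' by (auto simp: \<rho>_def)
  next
    fix U assume U: "openin (op_space 2) U"
    have "openin (op_space i) {x. (i, x) \<in> {p \<in> topspace all_op_space. \<rho> p \<in> U}}" if "i \<ge> 1" for i
    proof (cases "i = 2")
      case True
      then have "{x. (i, x) \<in> {p \<in> topspace all_op_space. \<rho> p \<in> U}} = U"
        using openin_subset[OF U] by (auto simp: \<rho>_def)
      then show ?thesis using U True by simp
    next
      case False
      then have "{x. (i, x) \<in> {p \<in> topspace all_op_space. \<rho> p \<in> U}} =
          (if f0 \<in> U then topspace (op_space i) else {})"
        using that by (auto simp: \<rho>_def)
      then show ?thesis by (auto simp del: topspace_op_space)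
    qed
    then show "openin all_op_space {p \<in> topspace all_op_space. \<rho> p \<in> U}"
      by (subst all_op_space_def, subst openin_sum_topology) auto
  qed
  then have "continuous_map baire_space (op_space 2) (\<rho> \<circ> h)"
    using h continuous_map_compose by blast
  moreover have "\<rho> ` A = {f. (2, f) \<in> A}"
    using f0 by (force simp: \<rho>_def image_iff split: if_splits)
  ultimately show ?thesis
    unfolding analytic_in_def using h by (metis image_comp topspace_baire_space)
qed (simp add: analytic_in_def)


section \<open>Coanalyticity\<close>

lemma fin_det_ord:
  "fin_det b \<Longrightarrow> fin_det g \<Longrightarrow> fin_det h \<Longrightarrow> fin_det (\<lambda>z. ord (b z) (g z) (h z))"
  unfolding ord_def by (intro fin_det_if fin_det_intros)

text \<open>In the coding by \<^const>\<open>cell\<close>, 0 and 1 hold the operation \<open>f\<close> and its arity minus one.  For a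
  \<^const>\<open>unary_witness\<close>, 2 and 3 enumerate \<open>S1\<close> and \<open>S2\<close>, 4 is \<open>c\<close>, 5 is \<open>G\<close> and 6 is \<open>e\<close>, with
  value 0 for truth.\<close>
definition unary_code_val :: "(nat \<Rightarrow> nat) \<Rightarrow> nat \<Rightarrow> nat \<Rightarrow> nat" where
  "unary_code_val z x y =
     cell z 0 (map (\<lambda>m. cell z 5 [m, if cell z 6 [m] = 0 then x else y]) [0..<Suc (cell z 1 [])])"

definition unary_code :: "nat \<times> nat \<times> nat \<times> nat \<Rightarrow> (nat \<Rightarrow> nat) \<Rightarrow> bool" where
  "unary_code = (\<lambda>(i, j, i', j') z.
     cell z 2 [i] < cell z 2 [Suc i] \<and> cell z 3 [i] < cell z 3 [Suc i] \<and>
     (ord (cell z 4 [] = 0) (cell z 2 [i]) (cell z 3 [j]) \<longrightarrow>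
      ord (cell z 4 [] = 0) (cell z 2 [i']) (cell z 3 [j']) \<longrightarrow>
      unary_code_val z (cell z 2 [i]) (cell z 3 [j]) = unary_code_val z (cell z 2 [i']) (cell z 3 [j']) \<longrightarrow>
      cell z 2 [i] = cell z 2 [i'] \<and> cell z 3 [j] = cell z 3 [j']))"

lemma fin_det_unary_code: "fin_det (unary_code n)"
proof (cases n)
  case (fields i j i' j')
  have "fin_det (\<lambda>z. unary_code (i, j, i', j') z)"
    unfolding unary_code_def unary_code_val_def prod.case
    by (intro fin_det_intros fin_det_if fin_det_ord)
  then show ?thesis using fields by simp
qed

text \<open>Infinitude of \<open>S1\<close> and \<open>S2\<close> is not a closed condition, so the
  code holds increasing enumerations; injectivity then splits into countably many conditions on four
  indices.\<close>

lemma unary_code_image: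
  "decode_op ` {z. \<forall>n. unary_code n z} = {(k, f) \<in> topspace all_op_space. inj_after_unary k f}"
proof (intro equalityI subsetI)
  fix p assume "p \<in> decode_op ` {z. \<forall>n. unary_code n z}"
  then obtain z where p: "p = decode_op z" and "\<forall>n. unary_code n z" by blast
  then have z: "unary_code (i, j, i', j') z" for i j i' j' by blast
  obtain k f where kf: "decode_op z = (k, f)" by fastforce
  then have k: "k = Suc (cell z 1 [])" and f: "f = (\<lambda>xs\<in>tuples k. cell z 0 xs)"
    by (auto simp: decode_op_def)
  define S1 S2 where "S1 = range (\<lambda>i. cell z 2 [i])" and "S2 = range (\<lambda>i. cell z 3 [i])"
  have "strict_mono (\<lambda>i. cell z 2 [i])" "strict_mono (\<lambda>i. cell z 3 [i])"
    using z by (auto simp: strict_mono_Suc_iff unary_code_def)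
  then have S: "infinite S1" "infinite S2"
    unfolding S1_def S2_def using range_inj_infinite strict_mono_imp_inj_on by blast+
  have val: "f (map (\<lambda>m. cell z 5 [m, if cell z 6 [m] = 0 then x else y]) [0..<k]) = unary_code_val z x y" for x y
    by (simp add: f k unary_code_val_def tuples_def del: upt_Suc)
  have "inj_on (\<lambda>(x, y). f (map (\<lambda>m. cell z 5 [m, if cell z 6 [m] = 0 then x else y]) [0..<k]))
      (tri (cell z 4 [] = 0) S1 S2)"
    unfolding val
  proof (rule inj_onI)
    fix p q
    assume pq: "p \<in> tri (cell z 4 [] = 0) S1 S2" "q \<in> tri (cell z 4 [] = 0) S1 S2"
      and eq: "(case p of (x, y) \<Rightarrow> unary_code_val z x y) = (case q of (x, y) \<Rightarrow> unary_code_val z x y)"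
    obtain i j where p: "p = (cell z 2 [i], cell z 3 [j])" "ord (cell z 4 [] = 0) (cell z 2 [i]) (cell z 3 [j])"
      using pq(1) by (cases p) (auto simp: mem_tri_ord S1_def S2_def)
    obtain i' j' where q: "q = (cell z 2 [i'], cell z 3 [j'])" "ord (cell z 4 [] = 0) (cell z 2 [i']) (cell z 3 [j'])"
      using pq(2) by (cases q) (auto simp: mem_tri_ord S1_def S2_def)
    show "p = q" using z[of i j i' j'] p q eq by (simp add: unary_code_def)
  qed
  then have "unary_witness k f (cell z 4 [] = 0) S1 S2 (\<lambda>m. cell z 6 [m] = 0) (\<lambda>m x. cell z 5 [m, x])"
    using S by (simp add: unary_witness_def)
  then have "inj_after_unary k f" unfolding inj_after_unary_def by blast
  then show "p \<in> {(k, f) \<in> topspace all_op_space. inj_after_unary k f}"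
    using kf by (simp add: p k f)
next
  fix p assume "p \<in> {(k, f) \<in> topspace all_op_space. inj_after_unary k f}"
  then obtain k f where p: "p = (k, f)" "k \<ge> 1" "f \<in> tuples k \<rightarrow>\<^sub>E UNIV" "inj_after_unary k f" by auto
  then obtain c S1 S2 e G where w: "unary_witness k f c S1 S2 e G"
    unfolding inj_after_unary_def by blast
  \<comment> \<open>Entry \<open>t\<close> of the list is the content of cell \<open>t\<close>. The
    arity is lowered by one because \<open>decode_op\<close> adds it back, and the Booleans are
    negated because 0 codes truth.\<close>
  define q where "q t xs = [f xs, k - 1, enumerate S1 (xs ! 0), enumerate S2 (xs ! 0), of_bool (\<not> c),
    G (xs ! 0) (xs ! 1), of_bool (\<not> e (xs ! 0))] ! t" for t xs
  obtain z where z: "cell z = q" using cell_surj by blast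
  have dec: "decode_op z = (k, f)"
    using p(2) by (auto simp: decode_op_def z q_def intro!: PiE_ext[OF _ p(3)])
  have val: "unary_code_val z x y = f (map (\<lambda>m. G m (if e m then x else y)) [0..<k])" for x y
    using p(2) by (simp add: unary_code_val_def z q_def del: upt_Suc)
  have S: "infinite S1" "infinite S2" using w by (simp_all add: unary_witness_def)
  have inj: "inj_on (\<lambda>(x, y). unary_code_val z x y) (tri c S1 S2)"
    using w unfolding val unary_witness_def by simp
  have "unary_code (i, j, i', j') z" for i j i' j'
  proof -
    have "ord c (enumerate S1 i) (enumerate S2 j) \<longrightarrow> ord c (enumerate S1 i') (enumerate S2 j') \<longrightarrow>
      unary_code_val z (enumerate S1 i) (enumerate S2 j) = unary_code_val z (enumerate S1 i') (enumerate S2 j') \<longrightarrow>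
      enumerate S1 i = enumerate S1 i' \<and> enumerate S2 j = enumerate S2 j'"
      using inj_onD[OF inj, of "(enumerate S1 i, enumerate S2 j)" "(enumerate S1 i', enumerate S2 j')"] S
      by (simp add: mem_tri_ord enumerate_in_set)
    then show ?thesis
      using S by (simp add: unary_code_def enumerate_step) (simp add: z q_def)
  qed
  then show "p \<in> decode_op ` {z. \<forall>n. unary_code n z}"
    using dec p(1) by (intro image_eqI[of _ _ z]) auto
qed

text \<open>For a \<^const>\<open>cross_witness\<close>, 2 to 6 hold \<open>x0\<close>, \<open>y0\<close>, \<open>e\<close>, \<open>B\<close> and \<open>g\<close>; 7 and 8 are
  choice functions for the two unboundedness conditions.\<close>
definition cross_code_val :: "(nat \<Rightarrow> nat) \<Rightarrow> nat \<Rightarrow> nat \<Rightarrow> nat" where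
  "cross_code_val z x y = cell z 0 (map (\<lambda>m. cell z 6 [m, x, y]) [0..<Suc (cell z 1 [])])"

definition cross_code :: "nat \<times> nat \<times> nat \<Rightarrow> (nat \<Rightarrow> nat) \<Rightarrow> bool" where
  "cross_code = (\<lambda>(m, i, b) z.
     (m < Suc (cell z 1 []) \<longrightarrow>
        (if cell z 4 [m] = 0 then cell z 6 [m, cell z 2 [], i] \<le> cell z 5 [m]
         else cell z 6 [m, i, cell z 3 []] \<le> cell z 5 [m])) \<and>
     b < cross_code_val z (cell z 2 []) (cell z 7 [b]) \<and>
     b < cross_code_val z (cell z 8 [b]) (cell z 3 []))"

lemma fin_det_cross_code: "fin_det (cross_code n)"
proof (cases n)
  case (fields m i b)
  have "fin_det (\<lambda>z. cross_code (m, i, b) z)"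
    unfolding cross_code_def cross_code_val_def prod.case
    by (intro fin_det_intros fin_det_if)
  then show ?thesis using fields by simp
qed

text \<open>Unboundedness alternates quantifiers; storing the choice functions turns it into one
  closed condition for each bound \<open>b\<close>.\<close>

lemma cross_code_image:
  "decode_op ` {z. \<forall>n. cross_code n z} = {(k, f) \<in> topspace all_op_space. unbounded_on_cross k f}"
proof (intro equalityI subsetI)
  fix p assume "p \<in> decode_op ` {z. \<forall>n. cross_code n z}"
  then obtain z where p: "p = decode_op z" and "\<forall>n. cross_code n z" by blast
  then have z: "cross_code (m, i, b) z" for m i b by blast
  obtain k f where kf: "decode_op z = (k, f)" by fastforce
  then have k: "k = Suc (cell z 1 [])" and f: "f = (\<lambda>xs\<in>tuples k. cell z 0 xs)"
    by (auto simp: decode_op_def)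
  have val: "f (map (\<lambda>m. cell z 6 [m, x, y]) [0..<k]) = cross_code_val z x y" for x y
    by (simp add: f k cross_code_val_def tuples_def del: upt_Suc)
  have "cross_witness k f (cell z 2 []) (cell z 3 []) (\<lambda>m. cell z 4 [m] = 0) (\<lambda>m. cell z 5 [m])
      (\<lambda>m x y. cell z 6 [m, x, y])"
    unfolding cross_witness_def val
  proof (intro conjI allI impI)
    fix m assume "m < k"
    then show "if cell z 4 [m] = 0 then \<forall>y. cell z 6 [m, cell z 2 [], y] \<le> cell z 5 [m]
        else \<forall>x. cell z 6 [m, x, cell z 3 []] \<le> cell z 5 [m]"
      using z[of m] by (auto simp: cross_code_def k)
  next
    fix b
    show "\<exists>y. b < cross_code_val z (cell z 2 []) y" "\<exists>x. b < cross_code_val z x (cell z 3 [])"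
      using z[of 0 0 b] by (auto simp: cross_code_def)
  qed
  then have "unbounded_on_cross k f" unfolding unbounded_on_cross_def by blast
  then show "p \<in> {(k, f) \<in> topspace all_op_space. unbounded_on_cross k f}"
    using kf by (simp add: p k f)
next
  fix p assume "p \<in> {(k, f) \<in> topspace all_op_space. unbounded_on_cross k f}"
  then obtain k f where p: "p = (k, f)" "k \<ge> 1" "f \<in> tuples k \<rightarrow>\<^sub>E UNIV" "unbounded_on_cross k f" by auto
  then obtain x0 y0 e B g where w: "cross_witness k f x0 y0 e B g"
    unfolding unbounded_on_cross_def by blast
  have "\<forall>b. \<exists>y. b < f (map (\<lambda>m. g m x0 y) [0..<k])" using w by (simp add: cross_witness_def)
  then obtain u where u: "\<And>b. b < f (map (\<lambda>m. g m x0 (u b)) [0..<k])" by metis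
  have "\<forall>b. \<exists>x. b < f (map (\<lambda>m. g m x y0) [0..<k])" using w by (simp add: cross_witness_def)
  then obtain v where v: "\<And>b. b < f (map (\<lambda>m. g m (v b) y0) [0..<k])" by metis
  define q where "q t xs = [f xs, k - 1, x0, y0, of_bool (\<not> e (xs ! 0)), B (xs ! 0),
    g (xs ! 0) (xs ! 1) (xs ! 2), u (xs ! 0), v (xs ! 0)] ! t" for t xs
  obtain z where z: "cell z = q" using cell_surj by blast
  have dec: "decode_op z = (k, f)"
    using p(2) by (auto simp: decode_op_def z q_def intro!: PiE_ext[OF _ p(3)])
  have val: "cross_code_val z x y = f (map (\<lambda>m. g m x y) [0..<k])" for x y
    using p(2) by (simp add: cross_code_val_def z q_def del: upt_Suc)
  have bd: "if e m then g m x0 i \<le> B m else g m i y0 \<le> B m" if "m < k" for m i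
    using w that by (auto simp: cross_witness_def split: if_splits)
  have "cross_code (m, i, b) z" for m i b
    using u[of b] v[of b] bd[of m i] p(2)
    by (simp add: cross_code_def val) (simp add: z q_def)
  then show "p \<in> decode_op ` {z. \<forall>n. cross_code n z}"
    using dec p(1) by (intro image_eqI[of _ _ z]) auto
qed

lemma analytic_not_Pol_T2: "analytic_in all_op_space (topspace all_op_space - Pol T2)"
proof -
  have "topspace all_op_space - Pol T2 = {(k, f) \<in> topspace all_op_space. inj_after_unary k f}"
    using Pol_T2_iff by auto
  then show ?thesis
    using analytic_in_closed_image[of unary_code, OF fin_det_unary_code continuous_decode_op]
    by (simp only: unary_code_image)
qed

lemma analytic_not_Pol_T1_T2: "analytic_in all_op_space (topspace all_op_space - Pol (T1 \<inter> T2))"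
proof -
  have "topspace all_op_space - Pol (T1 \<inter> T2) = {(k, f) \<in> topspace all_op_space. inj_after_unary k f} \<union>
      {(k, f) \<in> topspace all_op_space. unbounded_on_cross k f}"
    using Pol_T1_T2_iff by auto
  then show ?thesis
    using analytic_in_Un[OF
        analytic_in_closed_image[of unary_code, OF fin_det_unary_code continuous_decode_op]
        analytic_in_closed_image[of cross_code, OF fin_det_cross_code continuous_decode_op]]
    by (simp only: unary_code_image cross_code_image)
qed

lemma Pol_subset: "Pol B \<subseteq> topspace all_op_space"
  by (auto simp: Pol_def)

lemma coanalytic_Pol_T2: "coanalytic_in all_op_space (Pol T2)"
  using analytic_not_Pol_T2 Pol_subset by (simp add: coanalytic_in_def)

lemma coanalytic_Pol_T1_T2: "coanalytic_in all_op_space (Pol (T1 \<inter> T2))"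
  using analytic_not_Pol_T1_T2 Pol_subset by (simp add: coanalytic_in_def)

lemma coanalytic_binary:
  assumes "coanalytic_in all_op_space (Pol B)" "B \<subseteq> topspace (op_space 2)"
    "\<And>f. (2, f) \<in> Pol B \<longleftrightarrow> f \<in> B"
  shows "coanalytic_in (op_space 2) B"
proof -
  have "topspace (op_space 2) - B = {f. (2, f) \<in> topspace all_op_space - Pol B}"
    using assms(3) by auto
  then show ?thesis
    using analytic_in_binary assms(1,2) by (simp only: coanalytic_in_def)
qed

lemma coanalytic_T2: "coanalytic_in (op_space 2) T2"
  by (rule coanalytic_binary[OF coanalytic_Pol_T2 _ binary_Pol_T2_iff]) (auto simp: T2_def)

lemma coanalytic_T1_T2: "coanalytic_in (op_space 2) (T1 \<inter> T2)"
  by (rule coanalytic_binary[OF coanalytic_Pol_T1_T2 _ binary_Pol_T1_T2_iff]) (auto simp: T2_def)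


section \<open>Reduction of analytic sets to branches of trees\<close>

definition segment :: "(nat \<Rightarrow> nat) \<Rightarrow> nat \<Rightarrow> nat list" where
  "segment z n = rev (map z [0..<n])"

lemma length_segment [simp]: "length (segment z n) = n"
  by (simp add: segment_def)

lemma segment_Suc: "segment z (Suc n) = z n # segment z n"
  by (simp add: segment_def)

lemma rev_segment_nth: "i < n \<Longrightarrow> rev (segment z n) ! i = z i"
  by (simp add: segment_def)

lemma segment_eqI: "(\<And>i. i < length s \<Longrightarrow> rev s ! i = z i) \<Longrightarrow> s = segment z (length s)"
proof -
  assume "\<And>i. i < length s \<Longrightarrow> rev s ! i = z i"
  then have "rev s = rev (segment z (length s))"
    by (intro nth_equalityI) (simp_all add: rev_segment_nth del: rev_is_rev_conv)
  then show ?thesis by simp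
qed

lemma suffix_segment: "m \<le> n \<Longrightarrow> suffix (segment z m) (segment z n)"
  by (induction n rule: dec_induct) (simp_all add: segment_Suc suffix_ConsI)

lemma suffix_rev_nth: "suffix s t \<Longrightarrow> i < length s \<Longrightarrow> rev t ! i = rev s ! i"
  by (auto simp: suffix_def nth_append)

lemma strict_mono_list_encode_segment: "strict_mono (\<lambda>n. list_encode (segment z n))"
  by (simp add: strict_mono_Suc_iff segment_Suc le_prod_encode_2 le_imp_less_Suc)

text \<open>The words are stored with the last letter in front, so that a node of the tree extends
  its suffixes and \<^const>\<open>list_encode\<close> increases along branches.\<close>
definition tree_op :: "nat list set \<Rightarrow> nat \<times> nat \<Rightarrow> nat" where
  "tree_op T = (\<lambda>(p, q). if q < p \<and> suffix (list_decode q) (list_decode p) \<and> list_decode p \<in> T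
     then Suc (prod_encode (p, q)) else 0)"

section \<open>Branches and injectivity of the tree operation\<close>

lemma almost_unary_tree_op: "almost_unary (tree_op T)"
proof -
  have "tree_op T (p, q) \<le> Max (insert 0 ((\<lambda>q. Suc (prod_encode (p, q))) ` {..<p}))" for p q
    by (rule Max_ge) (auto simp: tree_op_def)
  then show ?thesis
    unfolding almost_unary_def
    by (intro disjI1 exI[of _ "\<lambda>p. Max (insert 0 ((\<lambda>q. Suc (prod_encode (p, q))) ` {..<p}))"]) blast
qed

text \<open>On pairs of codes along the branch the default 0 does not occur, so injectivity comes
  from \<open>prod_encode\<close>.\<close>

lemma branch_not_nowhere_injective:
  assumes "\<And>n. segment z n \<in> T"
  shows "\<not> nowhere_injective (tree_op T)"
proof -
  let ?c = "\<lambda>n. list_encode (segment z n)"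
  have c: "strict_mono ?c" by (rule strict_mono_list_encode_segment)
  have "tree_op T (p, q) = Suc (prod_encode (p, q))" if pq: "(p, q) \<in> tri True (range ?c) (range ?c)" for p q
  proof -
    obtain n m where nm: "p = ?c n" "q = ?c m" "q < p" using pq by (auto simp: mem_tri)
    then have "m < n" using c strict_mono_less by blast
    then show ?thesis using nm assms by (simp add: tree_op_def suffix_segment)
  qed
  then have "inj_on (tree_op T) (tri True (range ?c) (range ?c))"
    by (intro inj_onI) (auto simp: prod_encode_eq)
  moreover have "infinite (range ?c)" using c range_inj_infinite strict_mono_imp_inj_on by blast
  ultimately show ?thesis unfolding nowhere_injective_iff by blast
qed

text \<open>Injectivity permits a single zero on the triangle. This rules out the side where
  \<open>tree_op\<close> vanishes, and it gives any two columns a common node of \<open>T\<close>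
  above them; suffixes of one word are comparable.\<close>

lemma ex_chain_of_not_nowhere_injective:
  assumes suf: "\<forall>t\<in>T. \<forall>s. suffix s t \<longrightarrow> s \<in> T" and n: "\<not> nowhere_injective (tree_op T)"
  obtains C where "infinite C" "C \<subseteq> T" "\<forall>s\<in>C. \<forall>t\<in>C. suffix s t \<or> suffix t s"
proof -
  obtain c S1 S2 where S: "infinite S1" "infinite S2" and inj: "inj_on (tree_op T) (tri c S1 S2)"
    using n unfolding nowhere_injective_iff by blast
  have zero: "u = v" if "u \<in> tri c S1 S2" "v \<in> tri c S1 S2" "tree_op T u = 0" "tree_op T v = 0" for u v
    using inj_onD[OF inj] that by metis
  have c
  proof (rule ccontr)
    assume nc: "\<not> c"
    obtain x x' y y' where r: "x \<noteq> x'" "y \<noteq> y'" "{x, x'} \<times> {y, y'} \<subseteq> tri c S1 S2"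
      using ex_rectangle[OF S] by blast
    then have "(x, y) \<in> tri c S1 S2" "(x', y) \<in> tri c S1 S2" by auto
    moreover from this nc have "tree_op T (x, y) = 0" "tree_op T (x', y) = 0"
      by (auto simp: mem_tri tree_op_def)
    ultimately show False using zero r(1) by blast
  qed
  have gt: "\<exists>x\<in>S1. n < x" for n using S(1) infinite_nat_iff_unbounded by blast
  have common: "\<exists>p. list_decode p \<in> T \<and> suffix (list_decode q) (list_decode p) \<and> suffix (list_decode q') (list_decode p)"
    if q: "q \<in> S2" "q' \<in> S2" for q q'
  proof -
    obtain p1 where p1: "p1 \<in> S1" "max q q' < p1" using gt by blast
    obtain p2 where p2: "p2 \<in> S1" "p1 < p2" using gt by blast
    have "(p1, q) \<in> tri c S1 S2" "(p1, q') \<in> tri c S1 S2" "(p2, q) \<in> tri c S1 S2" "(p2, q') \<in> tri c S1 S2"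
      using p1 p2 q \<open>c\<close> by (auto simp: mem_tri)
    \<comment> \<open>At most one of these points is a zero of \<open>tree_op T\<close>, so one of
      the rows \<open>p1\<close>, \<open>p2\<close> has no zero in the columns \<open>q\<close> and
      \<open>q'\<close>.\<close>
    then have "(tree_op T (p1, q) \<noteq> 0 \<and> tree_op T (p1, q') \<noteq> 0) \<or> (tree_op T (p2, q) \<noteq> 0 \<and> tree_op T (p2, q') \<noteq> 0)"
      using zero p2(2) by (metis Pair_inject less_irrefl)
    then show ?thesis by (auto simp: tree_op_def split: if_splits)
  qed
  show ?thesis
  proof (rule that[of "list_decode ` S2"])
    show "infinite (list_decode ` S2)"
      using S(2) finite_imageD[of list_decode S2] by (metis inj_list_decode)
    show "list_decode ` S2 \<subseteq> T" using common suf by blast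
    show "\<forall>s\<in>list_decode ` S2. \<forall>t\<in>list_decode ` S2. suffix s t \<or> suffix t s"
      using common suffix_same_cases by blast
  qed
qed

text \<open>Comparable words of equal length coincide, so an infinite chain has unbounded lengths,
  and \<open>z i\<close> can be read off any member longer than \<open>i\<close>.\<close>

lemma branch_of_chain:
  assumes C: "infinite C" and comp: "\<forall>s\<in>C. \<forall>t\<in>C. suffix s t \<or> suffix t s"
  obtains z where "\<And>t. t \<in> C \<Longrightarrow> t = segment z (length t)" "\<And>n. \<exists>t\<in>C. n \<le> length t"
proof -
  have "inj_on length C"
    using comp by (intro inj_onI) (metis suffix_length_less less_irrefl suffix_order.le_imp_less_or_eq)
  then have "infinite (length ` C)" using C finite_imageD by blast
  then have long: "\<exists>t\<in>C. n \<le> length t" for n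
    by (metis infinite_nat_iff_unbounded_le imageE)
  then obtain s where s: "\<And>n. s n \<in> C" "\<And>n. n \<le> length (s n)" by metis
  define z where "z i = rev (s (Suc i)) ! i" for i
  have "t = segment z (length t)" if t: "t \<in> C" for t
  proof (rule segment_eqI)
    fix i assume i: "i < length t"
    have "i < length (s (Suc i))" using s(2)[of "Suc i"] by simp
    then show "rev t ! i = z i"
      using comp[rule_format, OF t s(1)[of "Suc i"]] i suffix_rev_nth unfolding z_def by metis
  qed
  then show ?thesis using long that by blast
qed

text \<open>\<open>e\<close> is any countable family of continuous coordinates that separates
  points, which covers both the binary operations and the sum space.\<close>

lemma analytic_reduction:
  fixes X :: "'a topology" and e :: "nat \<Rightarrow> 'a \<Rightarrow> nat"
  assumes A: "analytic_in X A"
    and cont: "\<And>n. continuous_map X (discrete_topology UNIV) (e n)"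
    and sep: "inj_on (\<lambda>x n. e n x) (topspace X)"
  obtains F where "continuous_map X (op_space 2) F" "\<And>x. F x \<in> T1"
    "\<And>x. x \<in> topspace X \<Longrightarrow> F x \<in> T2 \<longleftrightarrow> x \<notin> A"
proof (cases "A = {}")
  case True
  have "almost_unary (\<lambda>_. 0)" by (simp add: almost_unary_def)
  moreover have "nowhere_injective (\<lambda>_. 0)"
    by (rule nowhere_injective_cross) simp
  ultimately show ?thesis
    using True by (intro that[of "\<lambda>_. op2 (\<lambda>_. 0)"]) (simp_all add: op2_in_T1_iff op2_in_T2_iff)
next
  case False
  then obtain h where h: "continuous_map baire_space X h" "A = range h"
    using A by (auto simp: analytic_in_def)
  \<comment> \<open>The nodes are finite approximations to an \<open>h\<close>-preimage of
    \<open>x\<close>. Whether \<open>s\<close> is a node depends only on the first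
    \<open>length s\<close> coordinates of \<open>x\<close>; this makes \<open>F\<close>
    continuous.\<close>
  define T where "T x = {s. \<exists>z. s = segment z (length s) \<and> (\<forall>i<length s. e i (h z) = e i x)}" for x
  define F where "F x = op2 (tree_op (T x))" for x
  have hX: "h z \<in> topspace X" for z using h(1) by (auto simp: continuous_map_def)
  have "F x \<in> T2 \<longleftrightarrow> x \<notin> A" if x: "x \<in> topspace X" for x
  proof
    assume "F x \<in> T2"
    then have "nowhere_injective (tree_op (T x))" by (simp add: F_def op2_in_T2_iff)
    moreover have "segment z n \<in> T x" if "x = h z" for z n
      using that by (auto simp: T_def)
    ultimately show "x \<notin> A" using branch_not_nowhere_injective h(2) by blast
  next
    assume xA: "x \<notin> A"
    show "F x \<in> T2"
    proof (rule ccontr)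
      assume "F x \<notin> T2"
      then have n: "\<not> nowhere_injective (tree_op (T x))" by (simp add: F_def op2_in_T2_iff)
      have "s \<in> T x" if st: "t \<in> T x" "suffix s t" for s t
      proof -
        obtain z where z: "t = segment z (length t)" "\<forall>i<length t. e i (h z) = e i x"
          using st(1) unfolding T_def by blast
        have le: "length s \<le> length t" using st(2) suffix_length_le by blast
        have "s = segment z (length s)"
        proof (rule segment_eqI)
          fix i assume i: "i < length s"
          then have "rev s ! i = rev t ! i" using suffix_rev_nth[OF st(2)] by simp
          also have "\<dots> = z i" using i le z(1) rev_segment_nth[of i "length t" z] by simp
          finally show "rev s ! i = z i" .
        qed
        then show ?thesis using z(2) le by (auto simp: T_def)
      qed
      then have suf: "\<forall>t\<in>T x. \<forall>s. suffix s t \<longrightarrow> s \<in> T x" by blast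
      obtain C where C: "infinite C" "C \<subseteq> T x" "\<forall>s\<in>C. \<forall>t\<in>C. suffix s t \<or> suffix t s"
        using ex_chain_of_not_nowhere_injective[OF suf n] by blast
      obtain z where z: "\<And>t. t \<in> C \<Longrightarrow> t = segment z (length t)" "\<And>n. \<exists>t\<in>C. n \<le> length t"
        using branch_of_chain[OF C(1,3)] by blast
      \<comment> \<open>Each node has its own witness \<open>w\<close>, which need not be
        \<open>z\<close>. For a long node \<open>w\<close> agrees with \<open>z\<close> far enough
        for continuity of \<open>h\<close> to give \<open>e m (h w) = e m (h z)\<close>.\<close>
      have "e m (h z) = e m x" for m
      proof -
        have "fin_det (\<lambda>z. e m (h z))"
          unfolding fin_det_iff_continuous
          using continuous_map_compose[OF h(1) cont[of m]] by (simp add: comp_def)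
        then obtain n where n: "\<And>w. (\<forall>i<n. w i = z i) \<Longrightarrow> e m (h w) = e m (h z)"
          unfolding fin_det_def by blast
        obtain t where t: "t \<in> C" "max n (Suc m) \<le> length t" using z(2) by blast
        then obtain w where w: "t = segment w (length t)" "\<forall>i<length t. e i (h w) = e i x"
          using C(2) by (auto simp: T_def)
        have "w i = z i" if "i < n" for i
          using rev_segment_nth[of i "length t"] that t(2) w(1) z(1)[OF t(1)]
          by (metis less_le_trans max.bounded_iff)
        then have "e m (h w) = e m (h z)" using n by blast
        moreover have "e m (h w) = e m x" using w(2) t(2) by simp
        ultimately show ?thesis by simp
      qed
      then have "x = h z" using inj_onD[OF sep _ x hX, of z] by auto
      then show False using xA h(2) by blast
    qed
  qed
  moreover have "continuous_map X (op_space 2) F"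
    unfolding op_space_def continuous_map_componentwise
  proof (intro conjI ballI)
    show "F ` topspace X \<subseteq> extensional (tuples 2)" by (auto simp: F_def op2_def)
  next
    fix xs assume "xs \<in> tuples 2"
    then obtain p q where xs: "xs = [p, q]" by (auto simp: tuples_2_iff)
    show "continuous_map X (discrete_topology UNIV) (\<lambda>x. F x xs)"
    proof (rule continuous_map_discreteI)
      fix x assume x: "x \<in> topspace X"
      let ?U = "{y \<in> topspace X. \<forall>i<length (list_decode p). e i y = e i x}"
      have "openin X ?U" by (rule openin_agree[OF cont])
      moreover have "\<forall>y\<in>?U. F y xs = F x xs"
        by (auto simp: F_def xs tree_op_def T_def)
      ultimately show "\<exists>U. openin X U \<and> x \<in> U \<and> (\<forall>y\<in>U. F y xs = F x xs)"
        using x by (intro exI[of _ ?U] conjI) (assumption | simp)+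
    qed
  qed
  moreover have "F x \<in> T1" for x by (simp add: F_def op2_in_T1_iff almost_unary_tree_op)
  ultimately show ?thesis using that by blast
qed


section \<open>Completeness\<close>

text \<open>The hypothesis on \<open>B\<close> holds for both \<open>T2\<close> and
  \<open>T1 \<inter> T2\<close>; since the reduction takes values in \<open>T1\<close>, membership
  in \<open>B\<close> there is membership in \<open>T2\<close>.\<close>

lemma complete_coanalytic_binary:
  assumes "coanalytic_in (op_space 2) B" and B: "T1 \<inter> B = T1 \<inter> T2"
  shows "complete_coanalytic_in (op_space 2) B"
  unfolding complete_coanalytic_in_def
proof (intro conjI allI impI)
  fix C assume C: "coanalytic_in (op_space 2) C"
  define e where "e n f = (if list_decode n \<in> tuples 2 then f (list_decode n) else 0)" for n and f :: "nat list \<Rightarrow> nat"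
  have cont: "continuous_map (op_space 2) (discrete_topology UNIV) (e n)" for n
    using continuous_map_product_projection[of "list_decode n" "tuples 2" "\<lambda>_. discrete_topology UNIV"]
    by (cases "list_decode n \<in> tuples 2") (simp_all add: e_def[abs_def] op_space_def)
  have sep: "inj_on (\<lambda>f n. e n f) (topspace (op_space 2))"
  proof (rule inj_onI)
    fix f g assume fg: "f \<in> topspace (op_space 2)" "g \<in> topspace (op_space 2)" "(\<lambda>n. e n f) = (\<lambda>n. e n g)"
    show "f = g"
    proof (rule PiE_ext)
      show "f \<in> tuples 2 \<rightarrow>\<^sub>E UNIV" "g \<in> tuples 2 \<rightarrow>\<^sub>E UNIV" using fg by simp_all
      show "f xs = g xs" if "xs \<in> tuples 2" for xs
        using fun_cong[OF fg(3), of "list_encode xs"] that by (simp add: e_def)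
    qed
  qed
  have A: "analytic_in (op_space 2) (topspace (op_space 2) - C)"
    using C by (simp only: coanalytic_in_def)
  obtain F where "continuous_map (op_space 2) (op_space 2) F" "\<And>f. F f \<in> T1"
    "\<And>f. f \<in> topspace (op_space 2) \<Longrightarrow> F f \<in> T2 \<longleftrightarrow> f \<notin> topspace (op_space 2) - C"
    using analytic_reduction[OF A cont sep] by blast
  then show "\<exists>F. continuous_map (op_space 2) (op_space 2) F \<and> C = {f \<in> topspace (op_space 2). F f \<in> B}"
    using B C unfolding coanalytic_in_def by (intro exI[of _ F]) blast
qed (rule assms(1))

lemma complete_coanalytic_Pol:
  assumes "coanalytic_in all_op_space (Pol B)" and B: "T1 \<inter> B = T1 \<inter> T2"
    and binary: "\<And>f. (2, f) \<in> Pol B \<longleftrightarrow> f \<in> B"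
  shows "complete_coanalytic_in all_op_space (Pol B)"
  unfolding complete_coanalytic_in_def
proof (intro conjI allI impI)
  fix C assume C: "coanalytic_in all_op_space C"
  \<comment> \<open>Coordinate 0 is the arity: the zero operations of different arities agree in all
    other coordinates.\<close>
  define e where "e n = (\<lambda>(k, f :: nat list \<Rightarrow> nat). case n of 0 \<Rightarrow> k
    | Suc m \<Rightarrow> if list_decode m \<in> tuples k then f (list_decode m) else 0)" for n
  have cont: "continuous_map all_op_space (discrete_topology UNIV) (e n)" for n
    unfolding continuous_map_def
  proof (intro conjI allI impI)
    fix U :: "nat set"
    have "openin (op_space k) {f \<in> topspace (op_space k). e n (k, f) \<in> U}" for k
    proof (rule openin_continuous_map_preimage)
      show "continuous_map (op_space k) (discrete_topology UNIV) (\<lambda>f. e n (k, f))"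
        using continuous_map_product_projection[of "list_decode (n - 1)" "tuples k" "\<lambda>_. discrete_topology UNIV"]
        by (cases n; cases "list_decode (n - 1) \<in> tuples k") (simp_all add: e_def op_space_def)
    qed simp
    then show "openin all_op_space {p \<in> topspace all_op_space. e n p \<in> U}"
      by (subst all_op_space_def, subst openin_sum_topology) auto
  qed simp
  have sep: "inj_on (\<lambda>p n. e n p) (topspace all_op_space)"
  proof (rule inj_onI)
    fix p q assume pq: "p \<in> topspace all_op_space" "q \<in> topspace all_op_space" "(\<lambda>n. e n p) = (\<lambda>n. e n q)"
    obtain k f l g where kf: "p = (k, f)" "q = (l, g)" by fastforce
    have "k = l" using fun_cong[OF pq(3), of 0] by (simp add: kf e_def)
    moreover have "f = g"
    proof (rule PiE_ext)
      show "f \<in> tuples k \<rightarrow>\<^sub>E UNIV" "g \<in> tuples k \<rightarrow>\<^sub>E UNIV" using pq \<open>k = l\<close> by (simp_all add: kf)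
      show "f xs = g xs" if "xs \<in> tuples k" for xs
        using fun_cong[OF pq(3), of "Suc (list_encode xs)"] that \<open>k = l\<close> by (simp add: kf e_def)
    qed
    ultimately show "p = q" by (simp add: kf)
  qed
  have A: "analytic_in all_op_space (topspace all_op_space - C)"
    using C by (simp only: coanalytic_in_def)
  obtain F where F: "continuous_map all_op_space (op_space 2) F" "\<And>p. F p \<in> T1"
    "\<And>p. p \<in> topspace all_op_space \<Longrightarrow> F p \<in> T2 \<longleftrightarrow> p \<notin> topspace all_op_space - C"
    using analytic_reduction[OF A cont sep] by blast
  have "continuous_map (op_space 2) all_op_space (Pair 2)"
    unfolding all_op_space_def by (rule continuous_map_component_injection) simp
  from continuous_map_compose[OF F(1) this]
  have "continuous_map all_op_space all_op_space (\<lambda>p. (2, F p))" by (simp add: comp_def)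
  moreover have "C = {p \<in> topspace all_op_space. (2, F p) \<in> Pol B}"
    unfolding binary using F(2,3) B C unfolding coanalytic_in_def by blast
  ultimately show "\<exists>F. continuous_map all_op_space all_op_space F \<and> C = {p \<in> topspace all_op_space. F p \<in> Pol B}"
    by (intro exI[of _ "\<lambda>p. (2, F p)"]) simp
qed (rule assms(1))

theorem mainTheorem4:
  shows "complete_coanalytic_in (op_space 2) T2 \<and>
         complete_coanalytic_in all_op_space (Pol T2) \<and>
         complete_coanalytic_in (op_space 2) (T1 \<inter> T2) \<and>
         complete_coanalytic_in all_op_space (Pol (T1 \<inter> T2))"
  using complete_coanalytic_binary coanalytic_T2 coanalytic_T1_T2
    complete_coanalytic_Pol[OF coanalytic_Pol_T2 _ binary_Pol_T2_iff]
    complete_coanalytic_Pol[OF coanalytic_Pol_T1_T2 _ binary_Pol_T1_T2_iff]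
  by (simp add: Int_absorb)

end
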